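(* Let $\mathbf{M}$ be a left proper combinatorial model category, let $H$ be a small set of homotopy classes of morphisms of $\mathbf{M}$, and let $E$ be a right proper, admissibly left exact full subcategory of $\mathbf{M}$ containing all fibrant objects of $\mathbf{M}$. Let $\mathrm{loc}_E(H)$ be the full subcategory of $E$ consisting of the $H$-local objects, viewed as a full subcategory of the left Bousfield localization $L_H\mathbf{M}$. Then $\mathrm{loc}_E(H)$ is a right proper, admissibly left exact full subcategory of $L_H\mathbf{M}$, and it contains all fibrant objects of $L_H\mathbf{M}$.
   Context: Fix a Grothendieck universe; small and combinatorial are relative to it. A model category is combinatorial if it is cofibrantly generated by small sets and its underlying category is locally presentable. $\mathbf{R}\mathrm{Mor}_{\mathbf{M}}(X,Y)$ denotes the derived mapping space. A set of homotopy classes of morphisms of $\mathbf{M}$ is a set of morphisms of $\mathrm{Ho}\,\mathbf{M}$ (taken up to isomorphism). An object $Z$ is $H$-local if for every morphism $A\to B$ representing an element of $H$, $\mathbf{R}\mathrm{Mor}(B,Z)\to\mathbf{R}\mathrm{Mor}(A,Z)$ is an isomorphism in $\mathrm{Ho}\,s\mathbf{Set}$; a morphism $A\to B$ is an $H$-local equivalence if the same map is an isomorphism for every $H$-local $Z$. $L_H\mathbf{M}$ is the model structure on the category $\mathbf{M}$ with the same cofibrations as $\mathbf{M}$, weak equivalences the $H$-local equivalences, and fibrant objects the $H$-local objects that are fibrant in $\mathbf{M}$. For a model category $\mathbf{N}$ and a full subcategory $E$: $E$ is admissibly left exact if it contains the pullback of any morphism of $E$ along any fibration of $\mathbf{N}$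 lying in $E$ (an admissible pullback). Such an $E$ is right proper if admissible pullbacks in $E$ of weak equivalences of $\mathbf{N}$ are weak equivalences of $\mathbf{N}$. For $\mathrm{loc}_E(H)\subset L_H\mathbf{M}$ these notions use the fibrations and weak equivalences of $L_H\mathbf{M}$. *)

theory Defs
  imports "HOL-Library.FuncSet"
begin

unbundle cardinal_syntax

section \<open>Small sets\<close>

text \<open>
  The Grothendieck universe enters through its cardinality, a strongly inaccessible cardinal
  \<open>\<kappa>\<close>; a set of any type is small if its cardinality is below \<open>\<kappa>\<close>. The cardinal is carried
  by the type \<open>'m\<close> of morphisms of the category under consideration. This is no restriction,
  because the morphisms of a category may form a proper subset of \<open>'m\<close>. It guarantees that every
  small set is in bijection with a subset of \<open>'m\<close>, so that all small sets, small diagram shapes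
  and small simplicial sets occur, up to isomorphism, over the type \<open>'m\<close>.
\<close>

definition inaccessible :: "'m rel \<Rightarrow> bool" where
  "inaccessible \<kappa> \<longleftrightarrow>
     Card_order \<kappa> \<and> natLeq <o \<kappa> \<and> regularCard \<kappa> \<and>
     (\<forall>A :: 'm set. |A| <o \<kappa> \<longrightarrow> |Pow A| <o \<kappa>)"

definition small :: "'m rel \<Rightarrow> 'a set \<Rightarrow> bool" where
  "small \<kappa> A \<longleftrightarrow> |A| <o \<kappa>"


section \<open>Categories, functors, limits and colimits\<close>

record ('o, 'm) cat =
  Obj :: "'o set"
  Arr :: "'m set"
  Dom :: "'m \<Rightarrow> 'o"
  Cod :: "'m \<Rightarrow> 'o"
  Id :: "'o \<Rightarrow> 'm"
  Comp :: "'m \<Rightarrow> 'm \<Rightarrow> 'm"  \<comment> \<open>\<open>Comp C g f\<close> is \<open>g\<close> after \<open>f\<close>\<close>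

definition hom :: "('o, 'm, 'z) cat_scheme \<Rightarrow> 'o \<Rightarrow> 'o \<Rightarrow> 'm set" where
  "hom C x y = {f \<in> Arr C. Dom C f = x \<and> Cod C f = y}"

definition category :: "('o, 'm, 'z) cat_scheme \<Rightarrow> bool" where
  "category C \<longleftrightarrow>
     (\<forall>f\<in>Arr C. Dom C f \<in> Obj C \<and> Cod C f \<in> Obj C) \<and>
     (\<forall>x\<in>Obj C. Id C x \<in> hom C x x) \<and>
     (\<forall>f\<in>Arr C. \<forall>g\<in>Arr C. Cod C f = Dom C g \<longrightarrow> Comp C g f \<in> hom C (Dom C f) (Cod C g)) \<and>
     (\<forall>f\<in>Arr C. Comp C f (Id C (Dom C f)) = f \<and> Comp C (Id C (Cod C f)) f = f) \<and>
     (\<forall>f\<in>Arr C. \<forall>g\<in>Arr C. \<forall>h\<in>Arr C. Cod C f = Dom C g \<and> Cod C g = Dom C h \<longrightarrow>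
        Comp C h (Comp C g f) = Comp C (Comp C h g) f)"

definition iso :: "('o, 'm, 'z) cat_scheme \<Rightarrow> 'm \<Rightarrow> bool" where
  "iso C f \<longleftrightarrow> f \<in> Arr C \<and>
     (\<exists>g\<in>hom C (Cod C f) (Dom C f). Comp C g f = Id C (Dom C f) \<and> Comp C f g = Id C (Cod C f))"

definition op_cat :: "('o, 'm, 'z) cat_scheme \<Rightarrow> ('o, 'm) cat" where
  "op_cat C = \<lparr>Obj = Obj C, Arr = Arr C, Dom = Cod C, Cod = Dom C, Id = Id C,
     Comp = (\<lambda>g f. Comp C f g)\<rparr>"

definition locally_small :: "'m rel \<Rightarrow> ('o, 'm, 'z) cat_scheme \<Rightarrow> bool" where
  "locally_small \<kappa> C \<longleftrightarrow> (\<forall>x\<in>Obj C. \<forall>y\<in>Obj C. small \<kappa> (hom C x y))"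

record ('i, 'j, 'o, 'm) funct =
  fobj :: "'i \<Rightarrow> 'o"
  farr :: "'j \<Rightarrow> 'm"

text \<open>
  Functors and natural transformations are required to be undefined outside their domain, so that
  they are equal as soon as they agree there.
\<close>

definition is_functor ::
  "('i, 'j, 'y) cat_scheme \<Rightarrow> ('o, 'm, 'z) cat_scheme \<Rightarrow> ('i, 'j, 'o, 'm) funct \<Rightarrow> bool" where
  "is_functor J C F \<longleftrightarrow>
     fobj F \<in> Obj J \<rightarrow>\<^sub>E Obj C \<and> farr F \<in> Arr J \<rightarrow>\<^sub>E Arr C \<and>
     (\<forall>u\<in>Arr J. farr F u \<in> hom C (fobj F (Dom J u)) (fobj F (Cod J u))) \<and>
     (\<forall>j\<in>Obj J. farr F (Id J j) = Id C (fobj F j)) \<and>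
     (\<forall>u\<in>Arr J. \<forall>v\<in>Arr J. Cod J u = Dom J v \<longrightarrow>
        farr F (Comp J v u) = Comp C (farr F v) (farr F u))"

definition comp_functor ::
  "('i, 'j, 'y) cat_scheme \<Rightarrow> ('o, 'm, 'p, 'n) funct \<Rightarrow> ('i, 'j, 'o, 'm) funct
    \<Rightarrow> ('i, 'j, 'p, 'n) funct" where
  "comp_functor J G F = \<lparr>fobj = (\<lambda>j\<in>Obj J. fobj G (fobj F j)),
     farr = (\<lambda>u\<in>Arr J. farr G (farr F u))\<rparr>"

definition const_functor ::
  "('i, 'j, 'y) cat_scheme \<Rightarrow> ('o, 'm, 'z) cat_scheme \<Rightarrow> 'o \<Rightarrow> ('i, 'j, 'o, 'm) funct" where
  "const_functor J C x = \<lparr>fobj = (\<lambda>j\<in>Obj J. x), farr = (\<lambda>u\<in>Arr J. Id C x)\<rparr>"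

definition is_nat_trans ::
  "('i, 'j, 'y) cat_scheme \<Rightarrow> ('o, 'm, 'z) cat_scheme
    \<Rightarrow> ('i, 'j, 'o, 'm) funct \<Rightarrow> ('i, 'j, 'o, 'm) funct \<Rightarrow> ('i \<Rightarrow> 'm) \<Rightarrow> bool" where
  "is_nat_trans J C F G \<eta> \<longleftrightarrow>
     is_functor J C F \<and> is_functor J C G \<and> \<eta> \<in> extensional (Obj J) \<and>
     (\<forall>j\<in>Obj J. \<eta> j \<in> hom C (fobj F j) (fobj G j)) \<and>
     (\<forall>u\<in>Arr J. Comp C (\<eta> (Cod J u)) (farr F u) = Comp C (farr G u) (\<eta> (Dom J u)))"

type_synonym ('i, 'j, 'o, 'm) nat_arrow =
  "('i, 'j, 'o, 'm) funct \<times> ('i \<Rightarrow> 'm) \<times> ('i, 'j, 'o, 'm) funct"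

definition functor_cat ::
  "('i, 'j, 'y) cat_scheme \<Rightarrow> ('o, 'm, 'z) cat_scheme
    \<Rightarrow> (('i, 'j, 'o, 'm) funct, ('i, 'j, 'o, 'm) nat_arrow) cat" where
  "functor_cat J C = \<lparr>
     Obj = {F. is_functor J C F},
     Arr = {(F, \<eta>, G). is_nat_trans J C F G \<eta>},
     Dom = (\<lambda>(F, \<eta>, G). F),
     Cod = (\<lambda>(F, \<eta>, G). G),
     Id = (\<lambda>F. (F, \<lambda>j\<in>Obj J. Id C (fobj F j), F)),
     Comp = (\<lambda>(F', \<theta>, G') (F, \<eta>, G). (F, \<lambda>j\<in>Obj J. Comp C (\<theta> j) (\<eta> j), G'))\<rparr>"

abbreviation component :: "('i, 'j, 'o, 'm) nat_arrow \<Rightarrow> 'i \<Rightarrow> 'm" where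
  "component \<phi> \<equiv> fst (snd \<phi>)"

definition is_cone ::
  "('i, 'j, 'y) cat_scheme \<Rightarrow> ('o, 'm, 'z) cat_scheme \<Rightarrow> ('i, 'j, 'o, 'm) funct
    \<Rightarrow> 'o \<Rightarrow> ('i \<Rightarrow> 'm) \<Rightarrow> bool" where
  "is_cone J C D x \<pi> \<longleftrightarrow>
     x \<in> Obj C \<and> (\<forall>j\<in>Obj J. \<pi> j \<in> hom C x (fobj D j)) \<and>
     (\<forall>u\<in>Arr J. Comp C (farr D u) (\<pi> (Dom J u)) = \<pi> (Cod J u))"

definition is_limit ::
  "('i, 'j, 'y) cat_scheme \<Rightarrow> ('o, 'm, 'z) cat_scheme \<Rightarrow> ('i, 'j, 'o, 'm) funct
    \<Rightarrow> 'o \<Rightarrow> ('i \<Rightarrow> 'm) \<Rightarrow> bool" where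
  "is_limit J C D x \<pi> \<longleftrightarrow> is_cone J C D x \<pi> \<and>
     (\<forall>y \<rho>. is_cone J C D y \<rho> \<longrightarrow>
        (\<exists>!f. f \<in> hom C y x \<and> (\<forall>j\<in>Obj J. Comp C (\<pi> j) f = \<rho> j)))"

definition is_cocone ::
  "('i, 'j, 'y) cat_scheme \<Rightarrow> ('o, 'm, 'z) cat_scheme \<Rightarrow> ('i, 'j, 'o, 'm) funct
    \<Rightarrow> 'o \<Rightarrow> ('i \<Rightarrow> 'm) \<Rightarrow> bool" where
  "is_cocone J C D x \<iota> \<longleftrightarrow>
     x \<in> Obj C \<and> (\<forall>j\<in>Obj J. \<iota> j \<in> hom C (fobj D j) x) \<and>
     (\<forall>u\<in>Arr J. Comp C (\<iota> (Cod J u)) (farr D u) = \<iota> (Dom J u))"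

definition is_colimit ::
  "('i, 'j, 'y) cat_scheme \<Rightarrow> ('o, 'm, 'z) cat_scheme \<Rightarrow> ('i, 'j, 'o, 'm) funct
    \<Rightarrow> 'o \<Rightarrow> ('i \<Rightarrow> 'm) \<Rightarrow> bool" where
  "is_colimit J C D x \<iota> \<longleftrightarrow> is_cocone J C D x \<iota> \<and>
     (\<forall>y \<rho>. is_cocone J C D y \<rho> \<longrightarrow>
        (\<exists>!f. f \<in> hom C x y \<and> (\<forall>j\<in>Obj J. Comp C f (\<iota> j) = \<rho> j)))"

text \<open>A small category has a small set of arrows, hence (identities) of objects.\<close>

definition small_category :: "'m rel \<Rightarrow> ('m, 'm) cat \<Rightarrow> bool" where
  "small_category \<kappa> J \<longleftrightarrow> category J \<and> small \<kappa> (Arr J)"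

definition complete :: "'m rel \<Rightarrow> ('o, 'm, 'z) cat_scheme \<Rightarrow> bool" where
  "complete \<kappa> C \<longleftrightarrow>
     (\<forall>J D. small_category \<kappa> J \<and> is_functor J C D \<longrightarrow> (\<exists>x \<pi>. is_limit J C D x \<pi>))"

definition cocomplete :: "'m rel \<Rightarrow> ('o, 'm, 'z) cat_scheme \<Rightarrow> bool" where
  "cocomplete \<kappa> C \<longleftrightarrow>
     (\<forall>J D. small_category \<kappa> J \<and> is_functor J C D \<longrightarrow> (\<exists>x \<iota>. is_colimit J C D x \<iota>))"

definition terminal :: "('o, 'm, 'z) cat_scheme \<Rightarrow> 'o \<Rightarrow> bool" where
  "terminal C t \<longleftrightarrow> t \<in> Obj C \<and> (\<forall>x\<in>Obj C. \<exists>!f. f \<in> hom C x t)"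

text \<open>
  \<open>is_pullback C f p f' p'\<close>: the square with \<open>f \<circ> p' = p \<circ> f'\<close> is cartesian, so that \<open>f'\<close> is the
  pullback of \<open>f\<close> along \<open>p\<close>. Dually, \<open>is_pushout C f i f' i'\<close>: \<open>f'\<close> is the pushout of \<open>f\<close> along \<open>i\<close>.
\<close>

definition is_pullback ::
  "('o, 'm, 'z) cat_scheme \<Rightarrow> 'm \<Rightarrow> 'm \<Rightarrow> 'm \<Rightarrow> 'm \<Rightarrow> bool" where
  "is_pullback C f p f' p' \<longleftrightarrow>
     f \<in> Arr C \<and> p \<in> Arr C \<and> f' \<in> Arr C \<and> p' \<in> Arr C \<and>
     Cod C f = Cod C p \<and> Dom C f' = Dom C p' \<and> Cod C f' = Dom C p \<and> Cod C p' = Dom C f \<and>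
     Comp C f p' = Comp C p f' \<and>
     (\<forall>a\<in>Arr C. \<forall>b\<in>Arr C. Dom C a = Dom C b \<and> Cod C a = Dom C f \<and> Cod C b = Dom C p \<and>
        Comp C f a = Comp C p b \<longrightarrow>
        (\<exists>!c. c \<in> hom C (Dom C a) (Dom C p') \<and> Comp C p' c = a \<and> Comp C f' c = b))"

definition is_pushout ::
  "('o, 'm, 'z) cat_scheme \<Rightarrow> 'm \<Rightarrow> 'm \<Rightarrow> 'm \<Rightarrow> 'm \<Rightarrow> bool" where
  "is_pushout C f i f' i' \<longleftrightarrow> is_pullback (op_cat C) f i f' i'"


section \<open>Sets and locally presentable categories\<close>

type_synonym 'a set_arrow = "'a set \<times> ('a \<Rightarrow> 'a) \<times> 'a set"

definition set_cat :: "'a rel \<Rightarrow> ('a set, 'a set_arrow) cat" where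
  "set_cat \<kappa> = \<lparr>
     Obj = {A. small \<kappa> A},
     Arr = {(A, f, B). small \<kappa> A \<and> small \<kappa> B \<and> f \<in> A \<rightarrow>\<^sub>E B},
     Dom = (\<lambda>(A, f, B). A),
     Cod = (\<lambda>(A, f, B). B),
     Id = (\<lambda>A. (A, \<lambda>x\<in>A. x, A)),
     Comp = (\<lambda>(B', g, C) (A, f, B). (A, compose A g f, C))\<rparr>"

abbreviation set_map :: "'a set_arrow \<Rightarrow> 'a \<Rightarrow> 'a" where
  "set_map f \<equiv> fst (snd f)"

definition hom_functor ::
  "('o, 'm, 'z) cat_scheme \<Rightarrow> 'o \<Rightarrow> ('o, 'm, 'm set, 'm set_arrow) funct" where
  "hom_functor C x = \<lparr>
     fobj = (\<lambda>y\<in>Obj C. hom C x y),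
     farr = (\<lambda>g\<in>Arr C. (hom C x (Dom C g), \<lambda>f\<in>hom C x (Dom C g). Comp C g f,
                        hom C x (Cod C g)))\<rparr>"

text \<open>\<open>J\<close> is (the category of) a poset in which fewer than \<open>\<mu>\<close> elements have an upper bound.\<close>

definition directed_poset :: "'m rel \<Rightarrow> ('m, 'm) cat \<Rightarrow> bool" where
  "directed_poset \<mu> J \<longleftrightarrow> category J \<and>
     (\<forall>u\<in>Arr J. \<forall>v\<in>Arr J. Dom J u = Dom J v \<and> Cod J u = Cod J v \<longrightarrow> u = v) \<and>
     (\<forall>i\<in>Obj J. \<forall>j\<in>Obj J. hom J i j \<noteq> {} \<and> hom J j i \<noteq> {} \<longrightarrow> i = j) \<and>
     (\<forall>S. S \<subseteq> Obj J \<and> |S| <o \<mu> \<longrightarrow> (\<exists>j\<in>Obj J. \<forall>i\<in>S. hom J i j \<noteq> {}))"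

definition presentable_object ::
  "'m rel \<Rightarrow> 'm rel \<Rightarrow> ('o, 'm, 'z) cat_scheme \<Rightarrow> 'o \<Rightarrow> bool" where
  "presentable_object \<kappa> \<mu> C x \<longleftrightarrow> x \<in> Obj C \<and>
     (\<forall>J D y \<iota>. small_category \<kappa> J \<and> directed_poset \<mu> J \<and> is_functor J C D \<and>
        is_colimit J C D y \<iota> \<longrightarrow>
        is_colimit J (set_cat \<kappa>) (comp_functor J (hom_functor C x) D)
          (hom C x y) (\<lambda>j. farr (hom_functor C x) (\<iota> j)))"

definition locally_presentable :: "'m rel \<Rightarrow> ('o, 'm, 'z) cat_scheme \<Rightarrow> bool" where
  "locally_presentable \<kappa> C \<longleftrightarrow>
     category C \<and> locally_small \<kappa> C \<and> cocomplete \<kappa> C \<and>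
     (\<exists>\<mu> :: 'm rel. Card_order \<mu> \<and> natLeq \<le>o \<mu> \<and> regularCard \<mu> \<and> \<mu> <o \<kappa> \<and>
        (\<exists>S. S \<subseteq> Obj C \<and> small \<kappa> S \<and> (\<forall>s\<in>S. presentable_object \<kappa> \<mu> C s) \<and>
           (\<forall>x\<in>Obj C. \<exists>J D \<iota>. small_category \<kappa> J \<and> directed_poset \<mu> J \<and> is_functor J C D \<and>
              (\<forall>j\<in>Obj J. fobj D j \<in> S) \<and> is_colimit J C D x \<iota>)))"


section \<open>Model categories\<close>

record ('o, 'm) model_cat = "('o, 'm) cat" +
  Weq :: "'m set"
  Cof :: "'m set"
  Fib :: "'m set"

definition has_lifting :: "('o, 'm, 'z) cat_scheme \<Rightarrow> 'm \<Rightarrow> 'm \<Rightarrow> bool" where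
  "has_lifting C i p \<longleftrightarrow>
     (\<forall>u v. u \<in> hom C (Dom C i) (Dom C p) \<and> v \<in> hom C (Cod C i) (Cod C p) \<and>
        Comp C p u = Comp C v i \<longrightarrow>
        (\<exists>h\<in>hom C (Cod C i) (Dom C p). Comp C h i = u \<and> Comp C p h = v))"

definition is_retract :: "('o, 'm, 'z) cat_scheme \<Rightarrow> 'm \<Rightarrow> 'm \<Rightarrow> bool" where
  "is_retract C f g \<longleftrightarrow> f \<in> Arr C \<and> g \<in> Arr C \<and>
     (\<exists>i\<in>hom C (Dom C f) (Dom C g). \<exists>r\<in>hom C (Dom C g) (Dom C f).
      \<exists>i'\<in>hom C (Cod C f) (Cod C g). \<exists>r'\<in>hom C (Cod C g) (Cod C f).
        Comp C r i = Id C (Dom C f) \<and> Comp C r' i' = Id C (Cod C f) \<and>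
        Comp C g i = Comp C i' f \<and> Comp C f r = Comp C r' g)"

definition model_category :: "'m rel \<Rightarrow> ('o, 'm, 'z) model_cat_scheme \<Rightarrow> bool" where
  "model_category \<kappa> M \<longleftrightarrow>
     category M \<and> complete \<kappa> M \<and> cocomplete \<kappa> M \<and>
     Weq M \<subseteq> Arr M \<and> Cof M \<subseteq> Arr M \<and> Fib M \<subseteq> Arr M \<and>
     (\<forall>f\<in>Arr M. \<forall>g\<in>Arr M. Cod M f = Dom M g \<longrightarrow>
        (f \<in> Weq M \<and> g \<in> Weq M \<longrightarrow> Comp M g f \<in> Weq M) \<and>
        (f \<in> Weq M \<and> Comp M g f \<in> Weq M \<longrightarrow> g \<in> Weq M) \<and>
        (g \<in> Weq M \<and> Comp M g f \<in> Weq M \<longrightarrow> f \<in> Weq M)) \<and>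
     (\<forall>f g. is_retract M f g \<longrightarrow>
        (g \<in> Weq M \<longrightarrow> f \<in> Weq M) \<and> (g \<in> Cof M \<longrightarrow> f \<in> Cof M) \<and> (g \<in> Fib M \<longrightarrow> f \<in> Fib M)) \<and>
     (\<forall>i\<in>Cof M. \<forall>p\<in>Fib M. i \<in> Weq M \<or> p \<in> Weq M \<longrightarrow> has_lifting M i p) \<and>
     (\<forall>f\<in>Arr M. \<exists>i\<in>Cof M. \<exists>p\<in>Fib M \<inter> Weq M. Cod M i = Dom M p \<and> Comp M p i = f) \<and>
     (\<forall>f\<in>Arr M. \<exists>i\<in>Cof M \<inter> Weq M. \<exists>p\<in>Fib M. Cod M i = Dom M p \<and> Comp M p i = f)"

definition fibrant :: "('o, 'm, 'z) model_cat_scheme \<Rightarrow> 'o \<Rightarrow> bool" where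
  "fibrant M x \<longleftrightarrow> x \<in> Obj M \<and> (\<forall>t f. terminal M t \<and> f \<in> hom M x t \<longrightarrow> f \<in> Fib M)"

definition left_proper :: "('o, 'm, 'z) model_cat_scheme \<Rightarrow> bool" where
  "left_proper M \<longleftrightarrow>
     (\<forall>f i f' i'. is_pushout M f i f' i' \<and> f \<in> Weq M \<and> i \<in> Cof M \<longrightarrow> f' \<in> Weq M)"

text \<open>
  Cofibrant generation usually also asks the domains of \<open>I\<close> and \<open>J\<close> to be small relative to the
  respective cell complexes. In a locally presentable category every object is small, so this
  condition holds automatically and is not listed.
\<close>

definition combinatorial :: "'m rel \<Rightarrow> ('o, 'm, 'z) model_cat_scheme \<Rightarrow> bool" where
  "combinatorial \<kappa> M \<longleftrightarrow> model_category \<kappa> M \<and> locally_presentable \<kappa> M \<and>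
     (\<exists>I J. I \<subseteq> Arr M \<and> J \<subseteq> Arr M \<and> small \<kappa> I \<and> small \<kappa> J \<and>
        Fib M \<inter> Weq M = {p \<in> Arr M. \<forall>i\<in>I. has_lifting M i p} \<and>
        Fib M = {p \<in> Arr M. \<forall>j\<in>J. has_lifting M j p})"


section \<open>Homotopy categories\<close>

text \<open>
  The localization of a category at a class \<open>W\<close> of arrows: objects are unchanged, morphisms are
  zigzags (listed in order of traversal) modulo the congruence generated by the relations of the
  category and by making each \<open>Back w\<close> a two-sided inverse of \<open>Forth w\<close>.
\<close>

datatype 'm step = Forth 'm | Back 'm

inductive zigzag :: "('o, 'm, 'z) cat_scheme \<Rightarrow> 'm set \<Rightarrow> 'o \<Rightarrow> 'm step list \<Rightarrow> 'o \<Rightarrow> bool"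
  for C W where
  empty: "x \<in> Obj C \<Longrightarrow> zigzag C W x [] x"
| forward: "f \<in> Arr C \<Longrightarrow> zigzag C W (Cod C f) p y \<Longrightarrow> zigzag C W (Dom C f) (Forth f # p) y"
| backward: "w \<in> Arr C \<Longrightarrow> w \<in> W \<Longrightarrow> zigzag C W (Dom C w) p y \<Longrightarrow>
    zigzag C W (Cod C w) (Back w # p) y"

inductive zigzag_eq ::
  "('o, 'm, 'z) cat_scheme \<Rightarrow> 'm set \<Rightarrow> 'o \<Rightarrow> 'o \<Rightarrow> 'm step list \<Rightarrow> 'm step list \<Rightarrow> bool"
  for C W where
  refl: "zigzag C W x p y \<Longrightarrow> zigzag_eq C W x y p p"
| sym: "zigzag_eq C W x y p q \<Longrightarrow> zigzag_eq C W x y q p"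
| trans: "zigzag_eq C W x y p q \<Longrightarrow> zigzag_eq C W x y q r \<Longrightarrow> zigzag_eq C W x y p r"
| cong: "zigzag C W a l x \<Longrightarrow> zigzag_eq C W x y p q \<Longrightarrow> zigzag C W y r b \<Longrightarrow>
    zigzag_eq C W a b (l @ p @ r) (l @ q @ r)"
| ident: "x \<in> Obj C \<Longrightarrow> zigzag_eq C W x x [Forth (Id C x)] []"
| comp: "f \<in> Arr C \<Longrightarrow> g \<in> Arr C \<Longrightarrow> Cod C f = Dom C g \<Longrightarrow>
    zigzag_eq C W (Dom C f) (Cod C g) [Forth f, Forth g] [Forth (Comp C g f)]"
| forth_back: "w \<in> Arr C \<Longrightarrow> w \<in> W \<Longrightarrow> zigzag_eq C W (Dom C w) (Dom C w) [Forth w, Back w] []"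
| back_forth: "w \<in> Arr C \<Longrightarrow> w \<in> W \<Longrightarrow> zigzag_eq C W (Cod C w) (Cod C w) [Back w, Forth w] []"

type_synonym ('o, 'm) ho_arrow = "'o \<times> 'm step list set \<times> 'o"

definition zigzag_class ::
  "('o, 'm, 'z) cat_scheme \<Rightarrow> 'm set \<Rightarrow> 'o \<Rightarrow> 'm step list \<Rightarrow> 'o \<Rightarrow> ('o, 'm) ho_arrow" where
  "zigzag_class C W x p y = (x, {q. zigzag_eq C W x y p q}, y)"

definition Ho :: "('o, 'm, 'z) cat_scheme \<Rightarrow> 'm set \<Rightarrow> ('o, ('o, 'm) ho_arrow) cat" where
  "Ho C W = \<lparr>
     Obj = Obj C,
     Arr = {zigzag_class C W x p y | x p y. zigzag C W x p y},
     Dom = (\<lambda>(x, P, y). x),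
     Cod = (\<lambda>(x, P, y). y),
     Id = (\<lambda>x. zigzag_class C W x [] x),
     Comp = (\<lambda>(y', Q, z) (x, P, y).
       (x, {r. \<exists>p\<in>P. \<exists>q\<in>Q. zigzag_eq C W x z (p @ q) r}, z))\<rparr>"

definition ho_class :: "('o, 'm, 'z) cat_scheme \<Rightarrow> 'm set \<Rightarrow> 'm \<Rightarrow> ('o, 'm) ho_arrow" where
  "ho_class C W f = zigzag_class C W (Dom C f) [Forth f] (Cod C f)"

definition arrow_iso :: "('o, 'm, 'z) cat_scheme \<Rightarrow> ('m \<times> 'm) set" where
  "arrow_iso C = {(f, g). f \<in> Arr C \<and> g \<in> Arr C \<and>
     (\<exists>u\<in>hom C (Dom C f) (Dom C g). \<exists>v\<in>hom C (Cod C f) (Cod C g).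
        iso C u \<and> iso C v \<and> Comp C v f = Comp C g u)}"

text \<open>
  A homotopy class of morphisms is an isomorphism class of objects of the arrow category of the
  homotopy category.
\<close>

definition homotopy_classes ::
  "('o, 'm, 'z) model_cat_scheme \<Rightarrow> ('o, 'm) ho_arrow set set" where
  "homotopy_classes M = Arr (Ho M (Weq M)) // arrow_iso (Ho M (Weq M))"

definition represents :: "('o, 'm, 'z) model_cat_scheme \<Rightarrow> 'm \<Rightarrow> ('o, 'm) ho_arrow set \<Rightarrow> bool" where
  "represents M f h \<longleftrightarrow> f \<in> Arr M \<and> ho_class M (Weq M) f \<in> h"


section \<open>Simplicial sets\<close>

text \<open>The natural number \<open>n\<close> stands for the ordinal \<open>[n] = {0..n}\<close>.\<close>

type_synonym simplex_arrow = "nat \<times> (nat \<Rightarrow> nat) \<times> nat"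

definition simplex_cat :: "(nat, simplex_arrow) cat" where
  "simplex_cat = \<lparr>
     Obj = UNIV,
     Arr = {(m, \<theta>, n). \<theta> \<in> {..m} \<rightarrow>\<^sub>E {..n} \<and> mono_on {..m} \<theta>},
     Dom = (\<lambda>(m, \<theta>, n). m),
     Cod = (\<lambda>(m, \<theta>, n). n),
     Id = (\<lambda>n. (n, \<lambda>i\<in>{..n}. i, n)),
     Comp = (\<lambda>(n', \<psi>, k) (m, \<theta>, n). (m, compose {..m} \<psi> \<theta>, k))\<rparr>"

type_synonym 'a sset = "(nat, simplex_arrow, 'a set, 'a set_arrow) funct"
type_synonym 'a sset_arrow = "(nat, simplex_arrow, 'a set, 'a set_arrow) nat_arrow"

definition sset_cat :: "'a rel \<Rightarrow> ('a sset, 'a sset_arrow) cat" where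
  "sset_cat \<kappa> = functor_cat (op_cat simplex_cat) (set_cat \<kappa>)"

abbreviation act :: "'a sset \<Rightarrow> simplex_arrow \<Rightarrow> 'a \<Rightarrow> 'a" where
  "act X \<theta> \<equiv> set_map (farr X \<theta>)"

abbreviation smap :: "'a sset_arrow \<Rightarrow> nat \<Rightarrow> 'a \<Rightarrow> 'a" where
  "smap f n \<equiv> set_map (component f n)"

text \<open>The injection of \<open>[n]\<close> into \<open>[n + 1]\<close> that omits the value \<open>i\<close>.\<close>

definition coface :: "nat \<Rightarrow> nat \<Rightarrow> simplex_arrow" where
  "coface n i = (n, \<lambda>j\<in>{..n}. if j < i then j else Suc j, Suc n)"

text \<open>
  A horn is a family of \<open>n\<close>-simplices \<open>x i\<close>, for \<open>i \<le> n + 1\<close> and \<open>i \<noteq> k\<close>, whose faces match. For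
  \<open>n = 0\<close> there is no matching condition.
\<close>

definition Kan_complex :: "'a rel \<Rightarrow> 'a sset \<Rightarrow> bool" where
  "Kan_complex \<kappa> K \<longleftrightarrow> K \<in> Obj (sset_cat \<kappa>) \<and>
     (\<forall>n k x. k \<le> Suc n \<and> (\<forall>i\<le>Suc n. i \<noteq> k \<longrightarrow> x i \<in> fobj K n) \<and>
        (\<forall>i j. i < j \<and> j \<le> Suc n \<and> i \<noteq> k \<and> j \<noteq> k \<and> 0 < n \<longrightarrow>
           act K (coface (n - 1) i) (x j) = act K (coface (n - 1) (j - 1)) (x i)) \<longrightarrow>
        (\<exists>y\<in>fobj K (Suc n). \<forall>i\<le>Suc n. i \<noteq> k \<longrightarrow> act K (coface n i) y = x i))"

text \<open>
  A homotopy from \<open>f\<close> to \<open>g\<close> is a map from the product of \<open>Dom f\<close> and the standard 1-simplex to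
  \<open>Cod f\<close>; the \<open>n\<close>-simplices of the latter are the arrows \<open>\<tau>\<close> from \<open>[n]\<close> to \<open>[1]\<close>.
\<close>

definition homotopic :: "'a rel \<Rightarrow> 'a sset_arrow \<Rightarrow> 'a sset_arrow \<Rightarrow> bool" where
  "homotopic \<kappa> f g \<longleftrightarrow>
     f \<in> Arr (sset_cat \<kappa>) \<and> g \<in> Arr (sset_cat \<kappa>) \<and>
     Dom (sset_cat \<kappa>) f = Dom (sset_cat \<kappa>) g \<and> Cod (sset_cat \<kappa>) f = Cod (sset_cat \<kappa>) g \<and>
     (let X = Dom (sset_cat \<kappa>) f; Y = Cod (sset_cat \<kappa>) f in
      \<exists>h :: nat \<Rightarrow> 'a \<Rightarrow> simplex_arrow \<Rightarrow> 'a.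
        (\<forall>n. \<forall>x\<in>fobj X n. \<forall>\<tau>\<in>hom simplex_cat n 1. h n x \<tau> \<in> fobj Y n) \<and>
        (\<forall>m n. \<forall>\<theta>\<in>hom simplex_cat m n. \<forall>x\<in>fobj X n. \<forall>\<tau>\<in>hom simplex_cat n 1.
           h m (act X \<theta> x) (Comp simplex_cat \<tau> \<theta>) = act Y \<theta> (h n x \<tau>)) \<and>
        (\<forall>n. \<forall>x\<in>fobj X n. h n x (n, \<lambda>i\<in>{..n}. 0, 1) = smap f n x \<and>
                          h n x (n, \<lambda>i\<in>{..n}. 1, 1) = smap g n x))"

text \<open>
  A map of simplicial sets is a weak equivalence if it induces a bijection on homotopy classes of
  maps into each Kan complex. (Homotopy of maps into a Kan complex is an equivalence relation.)
\<close>

definition sset_weq :: "'a rel \<Rightarrow> 'a sset_arrow set" where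
  "sset_weq \<kappa> = {f \<in> Arr (sset_cat \<kappa>). \<forall>K. Kan_complex \<kappa> K \<longrightarrow>
     (\<forall>u\<in>hom (sset_cat \<kappa>) (Dom (sset_cat \<kappa>) f) K.
        \<exists>v\<in>hom (sset_cat \<kappa>) (Cod (sset_cat \<kappa>) f) K.
          homotopic \<kappa> (Comp (sset_cat \<kappa>) v f) u) \<and>
     (\<forall>v\<in>hom (sset_cat \<kappa>) (Cod (sset_cat \<kappa>) f) K.
      \<forall>v'\<in>hom (sset_cat \<kappa>) (Cod (sset_cat \<kappa>) f) K.
        homotopic \<kappa> (Comp (sset_cat \<kappa>) v f) (Comp (sset_cat \<kappa>) v' f) \<longrightarrow> homotopic \<kappa> v v')}"


section \<open>Derived mapping spaces\<close>

text \<open>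
  Objects of the \<open>n\<close>-th latching category are the non-identity injections into \<open>[n]\<close>, its arrows
  are the injections over \<open>[n]\<close>: \<open>(\<sigma>, \<tau>, \<rho>)\<close> is an arrow from \<open>\<sigma>\<close> to \<open>\<rho>\<close> if \<open>\<rho> \<circ> \<tau> = \<sigma>\<close>.
\<close>

definition injections :: "simplex_arrow set" where
  "injections = {(m, \<theta>, n) \<in> Arr simplex_cat. inj_on \<theta> {..m}}"

definition latching_cat ::
  "nat \<Rightarrow> (simplex_arrow, simplex_arrow \<times> simplex_arrow \<times> simplex_arrow) cat" where
  "latching_cat n = (let O' = {\<sigma> \<in> injections. Cod simplex_cat \<sigma> = n \<and> Dom simplex_cat \<sigma> < n} in
     \<lparr>Obj = O',
      Arr = {(\<sigma>, \<tau>, \<rho>). \<sigma> \<in> O' \<and> \<rho> \<in> O' \<and> \<tau> \<in> injections \<and>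
              \<tau> \<in> hom simplex_cat (Dom simplex_cat \<sigma>) (Dom simplex_cat \<rho>) \<and>
              Comp simplex_cat \<rho> \<tau> = \<sigma>},
      Dom = (\<lambda>(\<sigma>, \<tau>, \<rho>). \<sigma>),
      Cod = (\<lambda>(\<sigma>, \<tau>, \<rho>). \<rho>),
      Id = (\<lambda>\<sigma>. (\<sigma>, Id simplex_cat (Dom simplex_cat \<sigma>), \<sigma>)),
      Comp = (\<lambda>(\<rho>', \<tau>', \<pi>) (\<sigma>, \<tau>, \<rho>). (\<sigma>, Comp simplex_cat \<tau>' \<tau>, \<pi>))\<rparr>)"

type_synonym ('o, 'm) cosimplicial = "(nat, simplex_arrow, 'o, 'm) funct"
type_synonym ('o, 'm) cosimplicial_arrow = "(nat, simplex_arrow, 'o, 'm) nat_arrow"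

definition latching_diagram ::
  "nat \<Rightarrow> ('o, 'm) cosimplicial
    \<Rightarrow> (simplex_arrow, simplex_arrow \<times> simplex_arrow \<times> simplex_arrow, 'o, 'm) funct" where
  "latching_diagram n X = \<lparr>
     fobj = (\<lambda>\<sigma>\<in>Obj (latching_cat n). fobj X (Dom simplex_cat \<sigma>)),
     farr = (\<lambda>\<alpha>\<in>Arr (latching_cat n). farr X (fst (snd \<alpha>)))\<rparr>"

text \<open>Each latching map, from a colimit of the latching diagram to \<open>X [n]\<close>, is a cofibration.\<close>

definition Reedy_cofibrant :: "('o, 'm, 'z) model_cat_scheme \<Rightarrow> ('o, 'm) cosimplicial \<Rightarrow> bool" where
  "Reedy_cofibrant M X \<longleftrightarrow> is_functor simplex_cat M X \<and>
     (\<forall>n L \<iota> l. is_colimit (latching_cat n) M (latching_diagram n X) L \<iota> \<and>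
        l \<in> hom M L (fobj X n) \<and>
        (\<forall>\<sigma>\<in>Obj (latching_cat n). Comp M l (\<iota> \<sigma>) = farr X \<sigma>) \<longrightarrow> l \<in> Cof M)"

text \<open>
  A cosimplicial resolution of \<open>x\<close> is a Reedy cofibrant cosimplicial object together with a
  levelwise weak equivalence to the constant cosimplicial object at \<open>x\<close>.
\<close>

definition cosimplicial_resolution ::
  "('o, 'm, 'z) model_cat_scheme \<Rightarrow> 'o \<Rightarrow> ('o, 'm) cosimplicial_arrow \<Rightarrow> bool" where
  "cosimplicial_resolution M x a \<longleftrightarrow>
     (\<exists>X. a \<in> hom (functor_cat simplex_cat M) X (const_functor simplex_cat M x) \<and>
          Reedy_cofibrant M X \<and> (\<forall>n. component a n \<in> Weq M))"

definition fibrant_approximation :: "('o, 'm, 'z) model_cat_scheme \<Rightarrow> 'o \<Rightarrow> 'm \<Rightarrow> bool" where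
  "fibrant_approximation M z j \<longleftrightarrow> j \<in> Weq M \<and> Dom M j = z \<and> fibrant M (Cod M j)"

definition mapping_sset ::
  "('o, 'm, 'z) cat_scheme \<Rightarrow> ('o, 'm) cosimplicial \<Rightarrow> 'o \<Rightarrow> 'm sset" where
  "mapping_sset C X z = \<lparr>
     fobj = (\<lambda>n. hom C (fobj X n) z),
     farr = (\<lambda>\<theta>\<in>Arr simplex_cat.
       (hom C (fobj X (Cod simplex_cat \<theta>)) z,
        \<lambda>s\<in>hom C (fobj X (Cod simplex_cat \<theta>)) z. Comp C s (farr X \<theta>),
        hom C (fobj X (Dom simplex_cat \<theta>)) z))\<rparr>"

definition mapping_sset_map ::
  "('o, 'm, 'z) cat_scheme \<Rightarrow> ('o, 'm) cosimplicial_arrow \<Rightarrow> 'o \<Rightarrow> 'm sset_arrow" where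
  "mapping_sset_map C \<phi> z = (case \<phi> of (X, \<eta>, Y) \<Rightarrow>
     (mapping_sset C Y z,
      \<lambda>n. (hom C (fobj Y n) z, \<lambda>s\<in>hom C (fobj Y n) z. Comp C s (\<eta> n), hom C (fobj X n) z),
      mapping_sset C X z))"

text \<open>
  The derived mapping space from \<open>x\<close> to \<open>z\<close> is the (left) homotopy function complex of maps from a
  cosimplicial resolution of \<open>x\<close> to a fibrant approximation of \<open>z\<close>. For an arrow \<open>f\<close> from \<open>A\<close> to \<open>B\<close>,
  \<open>RMor_map M f z r\<close> says that \<open>r\<close> is a model of the induced map from the derived mapping space
  out of \<open>B\<close> to the one out of \<open>A\<close>, computed with resolutions \<open>a\<close>, \<open>b\<close> and a map \<open>\<phi>\<close> between them
  that covers \<open>f\<close>. In a model category such data exist, and all of them give isomorphic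
  morphisms in the homotopy category of simplicial sets.
\<close>

definition RMor_map :: "('o, 'm, 'z) model_cat_scheme \<Rightarrow> 'm \<Rightarrow> 'o \<Rightarrow> 'm sset_arrow \<Rightarrow> bool" where
  "RMor_map M f z r \<longleftrightarrow>
     (\<exists>a b \<phi> j. cosimplicial_resolution M (Dom M f) a \<and> cosimplicial_resolution M (Cod M f) b \<and>
        \<phi> \<in> hom (functor_cat simplex_cat M) (Dom (functor_cat simplex_cat M) a)
                                            (Dom (functor_cat simplex_cat M) b) \<and>
        (\<forall>n. Comp M (component b n) (component \<phi> n) = Comp M f (component a n)) \<and>
        fibrant_approximation M z j \<and> r = mapping_sset_map M \<phi> (Cod M j))"

definition RMor_iso :: "'m rel \<Rightarrow> ('o, 'm, 'z) model_cat_scheme \<Rightarrow> 'm \<Rightarrow> 'o \<Rightarrow> bool" where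
  "RMor_iso \<kappa> M f z \<longleftrightarrow>
     (\<forall>r. RMor_map M f z r \<longrightarrow>
        iso (Ho (sset_cat \<kappa>) (sset_weq \<kappa>)) (ho_class (sset_cat \<kappa>) (sset_weq \<kappa>) r))"


section \<open>Left Bousfield localization\<close>

definition local_object ::
  "'m rel \<Rightarrow> ('o, 'm, 'z) model_cat_scheme \<Rightarrow> ('o, 'm) ho_arrow set set \<Rightarrow> 'o \<Rightarrow> bool" where
  "local_object \<kappa> M H z \<longleftrightarrow> z \<in> Obj M \<and>
     (\<forall>f\<in>Arr M. (\<exists>h\<in>H. represents M f h) \<longrightarrow> RMor_iso \<kappa> M f z)"

definition local_equivalence ::
  "'m rel \<Rightarrow> ('o, 'm, 'z) model_cat_scheme \<Rightarrow> ('o, 'm) ho_arrow set set \<Rightarrow> 'm \<Rightarrow> bool" where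
  "local_equivalence \<kappa> M H f \<longleftrightarrow> f \<in> Arr M \<and> (\<forall>z. local_object \<kappa> M H z \<longrightarrow> RMor_iso \<kappa> M f z)"

text \<open>
  \<open>N\<close> is the left Bousfield localization of \<open>M\<close> at \<open>H\<close>. There is at most one such model structure,
  as the fibrations are determined by the cofibrations and the weak equivalences.
\<close>

definition is_left_Bousfield_localization ::
  "'m rel \<Rightarrow> ('o, 'm) model_cat \<Rightarrow> ('o, 'm) ho_arrow set set \<Rightarrow> ('o, 'm) model_cat \<Rightarrow> bool" where
  "is_left_Bousfield_localization \<kappa> M H N \<longleftrightarrow>
     model_category \<kappa> N \<and> cat.truncate N = cat.truncate M \<and>
     Cof N = Cof M \<and>
     Weq N = {f. local_equivalence \<kappa> M H f} \<and>
     {z. fibrant N z} = {z. local_object \<kappa> M H z \<and> fibrant M z}"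


section \<open>Full subcategories, given by their sets of objects\<close>

definition full_subcategory :: "('o, 'm, 'z) cat_scheme \<Rightarrow> 'o set \<Rightarrow> bool" where
  "full_subcategory C E \<longleftrightarrow> E \<subseteq> Obj C"

definition admissible_pullback ::
  "('o, 'm, 'z) model_cat_scheme \<Rightarrow> 'o set \<Rightarrow> 'm \<Rightarrow> 'm \<Rightarrow> 'm \<Rightarrow> 'm \<Rightarrow> bool" where
  "admissible_pullback N E f p f' p' \<longleftrightarrow> is_pullback N f p f' p' \<and> p \<in> Fib N \<and>
     Dom N f \<in> E \<and> Cod N f \<in> E \<and> Dom N p \<in> E \<and> Cod N p \<in> E"

definition admissibly_left_exact :: "('o, 'm, 'z) model_cat_scheme \<Rightarrow> 'o set \<Rightarrow> bool" where
  "admissibly_left_exact N E \<longleftrightarrow>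
     (\<forall>f p f' p'. admissible_pullback N E f p f' p' \<longrightarrow> Dom N f' \<in> E)"

definition right_proper_subcategory :: "('o, 'm, 'z) model_cat_scheme \<Rightarrow> 'o set \<Rightarrow> bool" where
  "right_proper_subcategory N E \<longleftrightarrow>
     (\<forall>f p f' p'. admissible_pullback N E f p f' p' \<and> f \<in> Weq N \<longrightarrow> f' \<in> Weq N)"

definition loc ::
  "'m rel \<Rightarrow> ('o, 'm, 'z) model_cat_scheme \<Rightarrow> 'o set \<Rightarrow> ('o, 'm) ho_arrow set set \<Rightarrow> 'o set" where
  "loc \<kappa> M E H = {z \<in> E. local_object \<kappa> M H z}"

end

(*
  No theory of mapping spaces is needed. M and N = L_H M have the same cofibrations, hence the same
  trivial fibrations, and every N-fibrant object is M-fibrant. This alone implies that weak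
  equivalences of M are weak equivalences of N, with a converse between N-fibrant objects. The derived
  mapping spaces into z depend on z only through its fibrant approximations, so z is H-local if and
  only if it admits an M-weak equivalence to an N-fibrant object. By right properness of E, an
  admissible pullback of H-local objects is M-equivalent to a pullback of N-fibrant objects along an
  N-fibration, so it is H-local; and an N-weak equivalence between H-local objects is an M-weak
  equivalence, so right properness of the local objects reduces to that of E.
*)

theory Submission
  imports Defs
begin

section \<open>Categories and pullbacks\<close>

text \<open>The obstacle is that an acyclic cofibration of M does not visibly lift against the
  fibrations of N: a condition on fibrant objects controls only fibrations to a terminal object. The
  bridge is the cylinder of \<open>relative_cylinder\<close>. Its projection is a trivial fibration,
  a notion common to both structures, so both ends of a cylinder are weak equivalences in M and in
  N, whichever structure produced the homotopy. Homotopies therefore carry information in both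
  directions. Since \<open>RMor_iso\<close> quantifies over all models of the mapping space,
  locality of an object involves every one of its fibrant approximations. This is the reason for
  \<open>essentially_fibrant_approximation\<close>: a single weak equivalence of M to an N-fibrant
  object forces every M-fibrant approximation to be N-fibrant.\<close>

locale cat_struct =
  fixes C :: "('o, 'm) cat"
  assumes category: "category C"
begin

abbreviation comp (infixr "\<cdot>" 70) where "g \<cdot> f \<equiv> Comp C g f"

lemma Dom_Obj [simp]: "f \<in> Arr C \<Longrightarrow> Dom C f \<in> Obj C"
  and Cod_Obj [simp]: "f \<in> Arr C \<Longrightarrow> Cod C f \<in> Obj C"
  and Id_simps [simp]: "x \<in> Obj C \<Longrightarrow> Id C x \<in> Arr C"
    "x \<in> Obj C \<Longrightarrow> Dom C (Id C x) = x" "x \<in> Obj C \<Longrightarrow> Cod C (Id C x) = x"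
  and comp_simps [simp]: "\<lbrakk>f \<in> Arr C; g \<in> Arr C; Cod C f = Dom C g\<rbrakk> \<Longrightarrow> g \<cdot> f \<in> Arr C"
    "\<lbrakk>f \<in> Arr C; g \<in> Arr C; Cod C f = Dom C g\<rbrakk> \<Longrightarrow> Dom C (g \<cdot> f) = Dom C f"
    "\<lbrakk>f \<in> Arr C; g \<in> Arr C; Cod C f = Dom C g\<rbrakk> \<Longrightarrow> Cod C (g \<cdot> f) = Cod C g"
  and Id_right [simp]: "\<lbrakk>f \<in> Arr C; Dom C f = x\<rbrakk> \<Longrightarrow> f \<cdot> Id C x = f"
  and Id_left [simp]: "\<lbrakk>f \<in> Arr C; Cod C f = x\<rbrakk> \<Longrightarrow> Id C x \<cdot> f = f"
  and assoc [simp]: "\<lbrakk>f \<in> Arr C; g \<in> Arr C; h \<in> Arr C; Cod C f = Dom C g; Cod C g = Dom C h\<rbrakk>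
    \<Longrightarrow> (h \<cdot> g) \<cdot> f = h \<cdot> g \<cdot> f"
  using category unfolding category_def hom_def by auto

lemma hom_self: "f \<in> Arr C \<Longrightarrow> f \<in> hom C (Dom C f) (Cod C f)"
  by (simp add: hom_def)

lemma homD:
  assumes "f \<in> hom C x y"
  shows "f \<in> Arr C" "Dom C f = x" "Cod C f = y" "x \<in> Obj C" "y \<in> Obj C"
  using assms Dom_Obj[of f] Cod_Obj[of f] by (auto simp: hom_def)

lemma comp_hom: "\<lbrakk>f \<in> hom C x y; g \<in> hom C y z\<rbrakk> \<Longrightarrow> g \<cdot> f \<in> hom C x z"
  by (simp add: hom_def)

lemma Id_hom: "x \<in> Obj C \<Longrightarrow> Id C x \<in> hom C x x"
  by (simp add: hom_def)

lemma hom_Id_left: "f \<in> hom C x y \<Longrightarrow> Id C y \<cdot> f = f"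
  and hom_Id_right: "f \<in> hom C x y \<Longrightarrow> f \<cdot> Id C x = f"
  by (auto simp: hom_def)

lemma hom_assoc:
  "\<lbrakk>f \<in> hom C w x; g \<in> hom C x y; h \<in> hom C y z\<rbrakk> \<Longrightarrow> (h \<cdot> g) \<cdot> f = h \<cdot> g \<cdot> f"
  by (simp add: hom_def)

lemma category_op: "category (op_cat C)"
  unfolding category_def op_cat_def hom_def by auto

lemma has_liftingI:
  assumes "i \<in> hom C a b" "p \<in> hom C x y"
    and "\<And>u v. \<lbrakk>u \<in> hom C a x; v \<in> hom C b y; p \<cdot> u = v \<cdot> i\<rbrakk>
      \<Longrightarrow> \<exists>h\<in>hom C b x. h \<cdot> i = u \<and> p \<cdot> h = v"
  shows "has_lifting C i p"
  using assms unfolding has_lifting_def hom_def by auto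

lemma has_liftingE:
  assumes "has_lifting C i p" "i \<in> hom C a b" "p \<in> hom C x y"
    and "u \<in> hom C a x" "v \<in> hom C b y" "p \<cdot> u = v \<cdot> i"
  obtains h where "h \<in> hom C b x" "h \<cdot> i = u" "p \<cdot> h = v"
  using assms unfolding has_lifting_def hom_def by auto

lemma is_retractI:
  assumes "f \<in> hom C x y" "g \<in> hom C x' y'" "i \<in> hom C x x'" "r \<in> hom C x' x"
    and "i' \<in> hom C y y'" "r' \<in> hom C y' y"
    and "r \<cdot> i = Id C x" "r' \<cdot> i' = Id C y" "g \<cdot> i = i' \<cdot> f" "f \<cdot> r = r' \<cdot> g"
  shows "is_retract C f g"
  unfolding is_retract_def homD(1,2,3)[OF assms(1)] homD(1,2,3)[OF assms(2)]
  using assms(3-) homD(1)[OF assms(1)] homD(1)[OF assms(2)] by blast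

text \<open>Unique existence is split into existence and joint monicity of \<open>p'\<close> and
  \<open>f'\<close>, the form in which diagram chases verify it.\<close>

lemma is_pullbackI:
  assumes "f \<in> hom C x z" "p \<in> hom C y z" "f' \<in> hom C w y" "p' \<in> hom C w x" "f \<cdot> p' = p \<cdot> f'"
    and "\<And>v a b. \<lbrakk>a \<in> hom C v x; b \<in> hom C v y; f \<cdot> a = p \<cdot> b\<rbrakk>
      \<Longrightarrow> \<exists>c\<in>hom C v w. p' \<cdot> c = a \<and> f' \<cdot> c = b"
    and "\<And>v c d. \<lbrakk>c \<in> hom C v w; d \<in> hom C v w; p' \<cdot> c = p' \<cdot> d; f' \<cdot> c = f' \<cdot> d\<rbrakk> \<Longrightarrow> c = d"
  shows "is_pullback C f p f' p'"
  unfolding is_pullback_def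
proof (intro conjI ballI impI)
  fix a b
  assume ab: "a \<in> Arr C" "b \<in> Arr C"
    "Dom C a = Dom C b \<and> Cod C a = Dom C f \<and> Cod C b = Dom C p \<and> f \<cdot> a = p \<cdot> b"
  then have "a \<in> hom C (Dom C a) x" "b \<in> hom C (Dom C a) y" "f \<cdot> a = p \<cdot> b"
    using assms(1,2) by (auto simp: hom_def)
  then obtain c where c: "c \<in> hom C (Dom C a) w" "p' \<cdot> c = a" "f' \<cdot> c = b"
    using assms(6) by blast
  show "\<exists>!c. c \<in> hom C (Dom C a) (Dom C p') \<and> p' \<cdot> c = a \<and> f' \<cdot> c = b"
    unfolding homD(2)[OF assms(4)]
  proof (rule ex1I[of _ c])
    fix d assume d: "d \<in> hom C (Dom C a) w \<and> p' \<cdot> d = a \<and> f' \<cdot> d = b"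
    show "d = c"
      by (rule assms(7)) (use c d in auto)
  qed (use c in simp)
next
  show "f \<cdot> p' = p \<cdot> f'"
    by (rule assms)
qed (simp_all add: homD(1-3)[OF assms(1)] homD(1-3)[OF assms(2)] homD(1-3)[OF assms(3)]
    homD(1-3)[OF assms(4)])

lemma is_pullback_ex1:
  assumes "is_pullback C f p f' p'" "f \<in> hom C x z" "p \<in> hom C y z" "p' \<in> hom C w x"
    and "a \<in> hom C v x" "b \<in> hom C v y" "f \<cdot> a = p \<cdot> b"
  shows "\<exists>!c. c \<in> hom C v w \<and> p' \<cdot> c = a \<and> f' \<cdot> c = b"
proof -
  have "Dom C a = Dom C b \<and> Cod C a = Dom C f \<and> Cod C b = Dom C p \<and> f \<cdot> a = p \<cdot> b"
    using assms(2,3,5-7) by (simp add: hom_def)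
  then have "\<exists>!c. c \<in> hom C (Dom C a) (Dom C p') \<and> p' \<cdot> c = a \<and> f' \<cdot> c = b"
    using assms(1)[unfolded is_pullback_def, THEN conjunct2, THEN conjunct2, THEN conjunct2,
        THEN conjunct2, THEN conjunct2, THEN conjunct2, THEN conjunct2, THEN conjunct2,
        THEN conjunct2, rule_format, OF homD(1)[OF assms(5)] homD(1)[OF assms(6)]]
    by simp
  then show ?thesis
    using homD(2)[OF assms(4)] homD(2)[OF assms(5)] by simp
qed

lemma is_pullback_lift:
  assumes "is_pullback C f p f' p'" "f \<in> hom C x z" "p \<in> hom C y z" "p' \<in> hom C w x"
    and "a \<in> hom C v x" "b \<in> hom C v y" "f \<cdot> a = p \<cdot> b"
  obtains c where "c \<in> hom C v w" "p' \<cdot> c = a" "f' \<cdot> c = b"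
  using is_pullback_ex1[OF assms] by blast

lemma is_pullbackE:
  assumes "is_pullback C f p f' p'"
  obtains x y z w where "f \<in> hom C x z" "p \<in> hom C y z" "f' \<in> hom C w y" "p' \<in> hom C w x"
    "f \<cdot> p' = p \<cdot> f'"
proof (rule that)
  show "f \<in> hom C (Dom C f) (Cod C f)" "p \<in> hom C (Dom C p) (Cod C f)"
    "f' \<in> hom C (Dom C f') (Dom C p)" "p' \<in> hom C (Dom C f') (Dom C f)" "f \<cdot> p' = p \<cdot> f'"
    using assms by (auto simp: is_pullback_def hom_def)
qed

lemma is_pullback_unique:
  assumes "is_pullback C f p f' p'" "p' \<in> hom C w x"
    and "c \<in> hom C v w" "d \<in> hom C v w" "p' \<cdot> c = p' \<cdot> d" "f' \<cdot> c = f' \<cdot> d"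
  shows "c = d"
proof -
  obtain x y z where *: "f \<in> hom C x z" "p \<in> hom C y z" "f' \<in> hom C w y" "p' \<in> hom C w x"
    "f \<cdot> p' = p \<cdot> f'"
    using assms(1,2) by (elim is_pullbackE) (auto simp: hom_def)
  have "f \<cdot> p' \<cdot> c = p \<cdot> f' \<cdot> c"
    using hom_assoc[OF assms(3) *(4,1)] hom_assoc[OF assms(3) *(3,2)] *(5) by simp
  moreover have "p' \<cdot> c \<in> hom C v x" "f' \<cdot> c \<in> hom C v y"
    using * assms(3) by (blast intro: comp_hom)+
  ultimately have "\<exists>!e. e \<in> hom C v w \<and> p' \<cdot> e = p' \<cdot> c \<and> f' \<cdot> e = f' \<cdot> c"
    using is_pullback_ex1[OF assms(1) *(1,2,4)] by blast
  then show ?thesis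
    using assms(3-6) by metis
qed

lemma is_pullback_sym:
  assumes "is_pullback C f p f' p'"
  shows "is_pullback C p f p' f'"
proof -
  obtain x y z w where *: "f \<in> hom C x z" "p \<in> hom C y z" "f' \<in> hom C w y" "p' \<in> hom C w x"
    "f \<cdot> p' = p \<cdot> f'"
    using assms by (rule is_pullbackE)
  show ?thesis
  proof (rule is_pullbackI[OF *(2,1,4,3) *(5)[symmetric]])
    fix v a b assume "a \<in> hom C v y" "b \<in> hom C v x" "p \<cdot> a = f \<cdot> b"
    then show "\<exists>c\<in>hom C v w. f' \<cdot> c = a \<and> p' \<cdot> c = b"
      using is_pullback_lift[OF assms *(1,2,4), of b v a] by metis
  next
    fix v c d assume "c \<in> hom C v w" "d \<in> hom C v w" "f' \<cdot> c = f' \<cdot> d" "p' \<cdot> c = p' \<cdot> d"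
    then show "c = d"
      using is_pullback_unique[OF assms *(4)] by metis
  qed
qed

lemma is_pullback_paste:
  assumes right: "is_pullback C g p g' p1" and left: "is_pullback C f p1 f' p2"
  shows "is_pullback C (g \<cdot> f) p (g' \<cdot> f') p2"
proof -
  obtain y1 z y u where R: "g \<in> hom C y1 y" "p \<in> hom C z y" "g' \<in> hom C u z" "p1 \<in> hom C u y1"
    "g \<cdot> p1 = p \<cdot> g'"
    using right by (rule is_pullbackE)
  obtain x w where L: "f \<in> hom C x y1" "f' \<in> hom C w u" "p2 \<in> hom C w x" "f \<cdot> p2 = p1 \<cdot> f'"
    using left R(4) by (elim is_pullbackE) (auto simp: hom_def)
  have comm: "(g \<cdot> f) \<cdot> p2 = p \<cdot> g' \<cdot> f'"
    using hom_assoc[OF L(3,1) R(1)] hom_assoc[OF L(2) R(4,1)] hom_assoc[OF L(2) R(3,2)] L(4) R(5)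
    by simp
  show ?thesis
  proof (rule is_pullbackI[OF comp_hom[OF L(1) R(1)] R(2) comp_hom[OF L(2) R(3)] L(3) comm])
    fix v a b assume ab: "a \<in> hom C v x" "b \<in> hom C v z" "(g \<cdot> f) \<cdot> a = p \<cdot> b"
    then have "g \<cdot> f \<cdot> a = p \<cdot> b"
      using hom_assoc[OF ab(1) L(1) R(1)] by simp
    then obtain c where c: "c \<in> hom C v u" "p1 \<cdot> c = f \<cdot> a" "g' \<cdot> c = b"
      using is_pullback_lift[OF right R(1,2,4) comp_hom[OF ab(1) L(1)] ab(2)] by metis
    obtain d where d: "d \<in> hom C v w" "p2 \<cdot> d = a" "f' \<cdot> d = c"
      using is_pullback_lift[OF left L(1) R(4) L(3) ab(1) c(1) c(2)[symmetric]] by metis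
    then show "\<exists>c\<in>hom C v w. p2 \<cdot> c = a \<and> (g' \<cdot> f') \<cdot> c = b"
      using c(3) hom_assoc[OF d(1) L(2) R(3)] by auto
  next
    fix v c d assume cd: "c \<in> hom C v w" "d \<in> hom C v w" "p2 \<cdot> c = p2 \<cdot> d"
      "(g' \<cdot> f') \<cdot> c = (g' \<cdot> f') \<cdot> d"
    have "g' \<cdot> f' \<cdot> c = g' \<cdot> f' \<cdot> d"
      using hom_assoc[OF cd(1) L(2) R(3)] hom_assoc[OF cd(2) L(2) R(3)] cd(4) by simp
    moreover have "p1 \<cdot> f' \<cdot> c = p1 \<cdot> f' \<cdot> d"
      using hom_assoc[OF cd(1) L(2) R(4)] hom_assoc[OF cd(2) L(2) R(4)]
        hom_assoc[OF cd(1) L(3,1)] hom_assoc[OF cd(2) L(3,1)] L(4) cd(3) by simp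
    ultimately have "f' \<cdot> c = f' \<cdot> d"
      using is_pullback_unique[OF right R(4) comp_hom[OF cd(1) L(2)] comp_hom[OF cd(2) L(2)]]
      by metis
    then show "c = d"
      using is_pullback_unique[OF left L(3) cd(1,2,3)] by metis
  qed
qed

text \<open>The comparison map comes from the outer rectangle; the right-hand square turns the
  remaining equation into two equations, after \<open>p1\<close> and after \<open>g'\<close>. The
  lemma later identifies comparison maps between pullbacks as base changes of weak
  equivalences.\<close>

lemma is_pullback_cancel:
  assumes right: "is_pullback C g p g' p1" and outer: "is_pullback C (g \<cdot> f) p (g' \<cdot> f') p2"
    and f: "f \<in> hom C x (Dom C g)" and f': "f' \<in> hom C w (Dom C g')" and comm: "f \<cdot> p2 = p1 \<cdot> f'"
  shows "is_pullback C f p1 f' p2"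
proof -
  obtain y1 z y u where R: "g \<in> hom C y1 y" "p \<in> hom C z y" "g' \<in> hom C u z" "p1 \<in> hom C u y1"
    "g \<cdot> p1 = p \<cdot> g'"
    using right by (rule is_pullbackE)
  have L: "f \<in> hom C x y1" "f' \<in> hom C w u"
    using f f' R by (auto simp: hom_def)
  have p2: "p2 \<in> hom C w x"
    using outer comp_hom[OF L(1) R(1)] comp_hom[OF L(2) R(3)]
    by (elim is_pullbackE) (auto simp: hom_def)
  show ?thesis
  proof (rule is_pullbackI[OF L(1) R(4) L(2) p2 comm])
    fix v a b assume ab: "a \<in> hom C v x" "b \<in> hom C v u" "f \<cdot> a = p1 \<cdot> b"
    have "(g \<cdot> f) \<cdot> a = p \<cdot> g' \<cdot> b"
      using hom_assoc[OF ab(1) L(1) R(1)] hom_assoc[OF ab(2) R(4) R(1)]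
        hom_assoc[OF ab(2) R(3) R(2)] R(5) ab(3) by simp
    then obtain c where c: "c \<in> hom C v w" "p2 \<cdot> c = a" "(g' \<cdot> f') \<cdot> c = g' \<cdot> b"
      using is_pullback_lift[OF outer comp_hom[OF L(1) R(1)] R(2) p2 ab(1) comp_hom[OF ab(2) R(3)]]
      by metis
    have "p1 \<cdot> f' \<cdot> c = p1 \<cdot> b"
      using hom_assoc[OF c(1) L(2) R(4)] hom_assoc[OF c(1) p2 L(1)] comm c(2) ab(3) by simp
    moreover have "g' \<cdot> f' \<cdot> c = g' \<cdot> b"
      using hom_assoc[OF c(1) L(2) R(3)] c(3) by simp
    ultimately have "f' \<cdot> c = b"
      using is_pullback_unique[OF right R(4) comp_hom[OF c(1) L(2)] ab(2)] by metis
    then show "\<exists>c\<in>hom C v w. p2 \<cdot> c = a \<and> f' \<cdot> c = b"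
      using c by auto
  next
    fix v c d assume cd: "c \<in> hom C v w" "d \<in> hom C v w" "p2 \<cdot> c = p2 \<cdot> d" "f' \<cdot> c = f' \<cdot> d"
    then have "(g' \<cdot> f') \<cdot> c = (g' \<cdot> f') \<cdot> d"
      using hom_assoc[OF cd(1) L(2) R(3)] hom_assoc[OF cd(2) L(2) R(3)] by simp
    then show "c = d"
      using is_pullback_unique[OF outer p2 cd(1,2,3)] by metis
  qed
qed

end

section \<open>Opposite categories and duality\<close>

lemma cat_struct_op: "cat_struct C \<Longrightarrow> cat_struct (op_cat C)"
  by (simp add: cat_struct_def cat_struct.category_op[unfolded cat_struct_def])

text \<open>Literal equality calls for a bare \<open>cat\<close> record, because
  \<open>op_cat\<close> discards any further fields. Hence the locales take \<open>C\<close> of type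
  \<open>('o, 'm) cat\<close>.\<close>

lemma op_op_cat [simp]: "op_cat (op_cat C) = C" for C :: "('o, 'm) cat"
  by (simp add: op_cat_def)

lemma op_cat_sel [simp]:
  "Obj (op_cat C) = Obj C" "Arr (op_cat C) = Arr C" "Dom (op_cat C) = Cod C"
  "Cod (op_cat C) = Dom C" "Id (op_cat C) = Id C" "Comp (op_cat C) g f = Comp C f g"
  by (simp_all add: op_cat_def)

lemma hom_op [simp]: "hom (op_cat C) x y = hom C y x"
  by (auto simp: hom_def)

lemma has_lifting_op:
  fixes C :: "('o, 'm) cat"
  shows "has_lifting (op_cat C) p i \<longleftrightarrow> has_lifting C i p"
proof -
  \<comment> \<open>One implication for all \<open>D\<close> suffices: its instance at
    \<open>op_cat C\<close> is the converse, as \<open>op_cat\<close> is an involution.\<close>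
  have *: "has_lifting (op_cat D) p i" if D: "has_lifting D i p" for D :: "('o, 'm) cat" and p i
    unfolding has_lifting_def op_cat_sel hom_op
  proof (intro allI impI)
    fix u v assume "u \<in> hom D (Cod D i) (Cod D p) \<and> v \<in> hom D (Dom D i) (Dom D p) \<and>
      Comp D u i = Comp D p v"
    then have "\<exists>h\<in>hom D (Cod D i) (Dom D p). Comp D h i = v \<and> Comp D p h = u"
      using D unfolding has_lifting_def by auto
    then show "\<exists>h\<in>hom D (Cod D i) (Dom D p). Comp D p h = u \<and> Comp D h i = v"
      by blast
  qed
  show ?thesis
    using *[of C i p] *[of "op_cat C" p i] by auto
qed

lemma is_retract_op:
  fixes C :: "('o, 'm) cat"
  shows "is_retract (op_cat C) f g \<longleftrightarrow> is_retract C f g"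
proof -
  have *: "is_retract (op_cat D) f g" if D: "is_retract D f g" for D :: "('o, 'm) cat"
  proof -
    from D obtain i r i' r' where "f \<in> Arr D" "g \<in> Arr D"
      "i \<in> hom D (Dom D f) (Dom D g)" "r \<in> hom D (Dom D g) (Dom D f)"
      "i' \<in> hom D (Cod D f) (Cod D g)" "r' \<in> hom D (Cod D g) (Cod D f)"
      "Comp D r i = Id D (Dom D f)" "Comp D r' i' = Id D (Cod D f)"
      "Comp D g i = Comp D i' f" "Comp D f r = Comp D r' g"
      unfolding is_retract_def by blast
    then show ?thesis
      unfolding is_retract_def op_cat_sel hom_op
      by (intro conjI bexI[of _ r'] bexI[of _ i'] bexI[of _ r] bexI[of _ i]) auto
  qed
  show ?thesis
    using *[of C] *[of "op_cat C"] by auto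
qed

context cat_struct
begin

lemma is_pushoutE:
  assumes "is_pushout C f i f' i'"
  obtains x y z w where "f \<in> hom C z x" "i \<in> hom C z y" "f' \<in> hom C y w" "i' \<in> hom C x w"
    "i' \<cdot> f = f' \<cdot> i"
  using cat_struct.is_pullbackE[OF cat_struct_op[OF cat_struct_axioms]
      assms[unfolded is_pushout_def]] by simp metis

lemma is_pushout_lift:
  assumes "is_pushout C f i f' i'" "f \<in> hom C z x" "i \<in> hom C z y" "i' \<in> hom C x w"
    and "a \<in> hom C x v" "b \<in> hom C y v" "a \<cdot> f = b \<cdot> i"
  obtains c where "c \<in> hom C w v" "c \<cdot> i' = a" "c \<cdot> f' = b"
  using cat_struct.is_pullback_lift[OF cat_struct_op[OF cat_struct_axioms]
      assms(1)[unfolded is_pushout_def], of x z y w a v b] assms(2-7) by simp blast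

end

section \<open>Weak factorization systems\<close>

locale wfs = cat_struct C for C :: "('o, 'm) cat" +
  fixes L R :: "'m set"
  assumes L_Arr: "L \<subseteq> Arr C" and R_Arr: "R \<subseteq> Arr C"
    and L_retract: "\<lbrakk>is_retract C f g; g \<in> L\<rbrakk> \<Longrightarrow> f \<in> L"
    and R_retract: "\<lbrakk>is_retract C f g; g \<in> R\<rbrakk> \<Longrightarrow> f \<in> R"
    and lifting: "\<lbrakk>i \<in> L; p \<in> R\<rbrakk> \<Longrightarrow> has_lifting C i p"
    and factor: "f \<in> Arr C \<Longrightarrow> \<exists>i\<in>L. \<exists>p\<in>R. Cod C i = Dom C p \<and> Comp C p i = f"
begin

lemma factorE:
  assumes "f \<in> hom C x y"
  obtains d i p where "i \<in> L" "p \<in> R" "i \<in> hom C x d" "p \<in> hom C d y" "p \<cdot> i = f"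
proof -
  obtain i p where *: "i \<in> L" "p \<in> R" "Cod C i = Dom C p" "p \<cdot> i = f"
    using factor[OF homD(1)[OF assms]] by blast
  have "i \<in> Arr C" "p \<in> Arr C"
    using * L_Arr R_Arr by auto
  then have "i \<in> hom C x (Dom C p)" "p \<in> hom C (Dom C p) y"
    using * assms by (auto simp: hom_def)
  then show thesis
    using that * by blast
qed

lemma liftE:
  assumes "i \<in> L" "p \<in> R" "i \<in> hom C a b" "p \<in> hom C x y"
    and "u \<in> hom C a x" "v \<in> hom C b y" "p \<cdot> u = v \<cdot> i"
  obtains h where "h \<in> hom C b x" "h \<cdot> i = u" "p \<cdot> h = v"
  using has_liftingE[OF lifting[OF assms(1,2)] assms(3-7)] by blast

text \<open>Turns closure of \<open>R\<close> under pullback and composition into closure of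
  \<open>L\<close> under pushout and composition.\<close>

lemma dual: "wfs (op_cat C) R L"
proof
  show "\<exists>i\<in>R. \<exists>p\<in>L. Cod (op_cat C) i = Dom (op_cat C) p \<and> Comp (op_cat C) p i = f"
    if "f \<in> Arr (op_cat C)" for f
    using factor[of f] that by (metis op_cat_sel(2,3,4,6))
qed (use category_op L_Arr R_Arr L_retract R_retract lifting
  in \<open>auto simp: has_lifting_op is_retract_op\<close>)

text \<open>Factoring \<open>p\<close> as \<open>q \<cdot> i\<close>, a lift of \<open>i\<close> against \<open>p\<close> exhibits \<open>p\<close> as a retract of \<open>q\<close>.\<close>

lemma R_iff: "p \<in> R \<longleftrightarrow> p \<in> Arr C \<and> (\<forall>i\<in>L. has_lifting C i p)"
proof
  assume "p \<in> Arr C \<and> (\<forall>i\<in>L. has_lifting C i p)"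
  then have p: "p \<in> Arr C" and lift: "\<And>i. i \<in> L \<Longrightarrow> has_lifting C i p"
    by auto
  obtain x y where ph: "p \<in> hom C x y"
    using p hom_self by blast
  obtain d i q where f: "i \<in> L" "q \<in> R" "i \<in> hom C x d" "q \<in> hom C d y" "q \<cdot> i = p"
    using ph by (rule factorE)
  have "p \<cdot> Id C x = q \<cdot> i"
    using f ph by (simp add: hom_Id_right)
  then obtain r where r: "r \<in> hom C d x" "r \<cdot> i = Id C x" "p \<cdot> r = q"
    using has_liftingE[OF lift[OF f(1)] f(3) ph Id_hom f(4)] homD[OF ph] by metis
  have "is_retract C p q"
    by (rule is_retractI[OF ph f(4,3) r(1) Id_hom Id_hom])
      (use r f ph homD[OF ph] in \<open>simp_all add: hom_Id_left\<close>)
  then show "p \<in> R"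
    using R_retract f(2) by blast
qed (use R_Arr lifting in auto)

text \<open>By \<open>R_iff\<close> only fillers have to be found. A filler of the composed square,
  together with the bottom edge \<open>v\<close>, induces a map into the pullback; its upper
  triangle commutes by joint monicity.\<close>

lemma R_pullback:
  assumes pb: "is_pullback C f p f' p'" and "p \<in> R"
  shows "p' \<in> R"
proof -
  obtain x y z w where *: "f \<in> hom C x z" "p \<in> hom C y z" "f' \<in> hom C w y" "p' \<in> hom C w x"
    "f \<cdot> p' = p \<cdot> f'"
    using pb by (rule is_pullbackE)
  have "has_lifting C i p'" if "i \<in> L" for i
  proof -
    obtain a b where i: "i \<in> hom C a b"
      using \<open>i \<in> L\<close> L_Arr hom_self by blast
    show ?thesis
    proof (rule has_liftingI[OF i *(4)])
      fix u v assume uv: "u \<in> hom C a w" "v \<in> hom C b x" "p' \<cdot> u = v \<cdot> i"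
      have "p \<cdot> f' \<cdot> u = (f \<cdot> v) \<cdot> i"
        using hom_assoc[OF uv(1) *(3,2)] hom_assoc[OF uv(1) *(4,1)] hom_assoc[OF i uv(2) *(1)]
          *(5) uv(3) by simp
      then obtain h where h: "h \<in> hom C b y" "h \<cdot> i = f' \<cdot> u" "p \<cdot> h = f \<cdot> v"
        using liftE[OF \<open>i \<in> L\<close> \<open>p \<in> R\<close> i *(2) comp_hom[OF uv(1) *(3)] comp_hom[OF uv(2) *(1)]]
        by metis
      obtain c where c: "c \<in> hom C b w" "p' \<cdot> c = v" "f' \<cdot> c = h"
        using is_pullback_lift[OF pb *(1,2,4) uv(2) h(1) h(3)[symmetric]] by metis
      have "p' \<cdot> c \<cdot> i = p' \<cdot> u" "f' \<cdot> c \<cdot> i = f' \<cdot> u"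
        using hom_assoc[OF i c(1) *(4)] hom_assoc[OF i c(1) *(3)] c(2,3) h(2) uv(3) by simp_all
      then have "c \<cdot> i = u"
        using is_pullback_unique[OF pb *(4) comp_hom[OF i c(1)] uv(1)] by metis
      then show "\<exists>h\<in>hom C b w. h \<cdot> i = u \<and> p' \<cdot> h = v"
        using c by blast
    qed
  qed
  then show ?thesis
    using R_iff homD(1)[OF *(4)] by blast
qed

lemma R_comp:
  assumes p: "p \<in> R" "p \<in> hom C x y" and q: "q \<in> R" "q \<in> hom C y z"
  shows "q \<cdot> p \<in> R"
proof -
  have "has_lifting C i (q \<cdot> p)" if "i \<in> L" for i
  proof -
    obtain a b where i: "i \<in> hom C a b"
      using \<open>i \<in> L\<close> L_Arr hom_self by blast
    show ?thesis
    proof (rule has_liftingI[OF i comp_hom[OF p(2) q(2)]])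
      fix u v assume uv: "u \<in> hom C a x" "v \<in> hom C b z" "(q \<cdot> p) \<cdot> u = v \<cdot> i"
      have "q \<cdot> p \<cdot> u = v \<cdot> i"
        using hom_assoc[OF uv(1) p(2) q(2)] uv(3) by simp
      then obtain g where g: "g \<in> hom C b y" "g \<cdot> i = p \<cdot> u" "q \<cdot> g = v"
        using liftE[OF \<open>i \<in> L\<close> q(1) i q(2) comp_hom[OF uv(1) p(2)] uv(2)] by metis
      obtain h where h: "h \<in> hom C b x" "h \<cdot> i = u" "p \<cdot> h = g"
        using liftE[OF \<open>i \<in> L\<close> p(1) i p(2) uv(1) g(1) g(2)[symmetric]] by metis
      then show "\<exists>h\<in>hom C b x. h \<cdot> i = u \<and> (q \<cdot> p) \<cdot> h = v"
        using g p q hom_assoc[OF h(1) p(2) q(2)] by auto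
    qed
  qed
  then show ?thesis
    using R_iff homD(1)[OF comp_hom[OF p(2) q(2)]] by blast
qed

lemma L_pushout: "\<lbrakk>is_pushout C f i f' i'; i \<in> L\<rbrakk> \<Longrightarrow> i' \<in> L"
  using wfs.R_pullback[OF dual] by (simp add: is_pushout_def)

lemma L_comp: "\<lbrakk>i \<in> L; i \<in> hom C x y; j \<in> L; j \<in> hom C y z\<rbrakk> \<Longrightarrow> j \<cdot> i \<in> L"
  using wfs.R_comp[OF dual, of j z y i x] by simp

end

section \<open>Model structures\<close>

locale pullbacks_pushouts = cat_struct C for C :: "('o, 'm) cat" +
  assumes terminal_ex: "\<exists>t. terminal C t"
    and pullback_ex: "\<lbrakk>f \<in> hom C x z; p \<in> hom C y z\<rbrakk> \<Longrightarrow> \<exists>f' p'. is_pullback C f p f' p'"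
    and pushout_ex: "\<lbrakk>f \<in> hom C z x; i \<in> hom C z y\<rbrakk> \<Longrightarrow> \<exists>f' i'. is_pushout C f i f' i'"
begin

lemma terminal_unique: "\<lbrakk>terminal C t; f \<in> hom C x t; g \<in> hom C x t\<rbrakk> \<Longrightarrow> f = g"
  using homD(4)[of f x t] unfolding terminal_def by blast

lemma terminal_hom: "\<lbrakk>terminal C t; x \<in> Obj C\<rbrakk> \<Longrightarrow> \<exists>f. f \<in> hom C x t"
  unfolding terminal_def by blast

end

text \<open>The three classes are parameters over a bare category instead of record fields, so that
  two structures on one category can be interpreted side by side. The prefixes \<open>tc\<close> and
  \<open>tf\<close> mark the systems with trivial cofibrations and with trivial fibrations.\<close>

locale model_structure = pullbacks_pushouts C + tc: wfs C "Cf \<inter> W" Fb + tf: wfs C Cf "Fb \<inter> W"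
  for C :: "('o, 'm) cat" and W Cf Fb +
  assumes W_Arr: "W \<subseteq> Arr C"
    and W_retract: "\<lbrakk>is_retract C f g; g \<in> W\<rbrakk> \<Longrightarrow> f \<in> W"
    and W_comp: "\<lbrakk>f \<in> hom C x y; g \<in> hom C y z; f \<in> W; g \<in> W\<rbrakk> \<Longrightarrow> g \<cdot> f \<in> W"
    and W_cancel_right: "\<lbrakk>f \<in> hom C x y; g \<in> hom C y z; f \<in> W; g \<cdot> f \<in> W\<rbrakk> \<Longrightarrow> g \<in> W"
    and W_cancel_left: "\<lbrakk>f \<in> hom C x y; g \<in> hom C y z; g \<in> W; g \<cdot> f \<in> W\<rbrakk> \<Longrightarrow> f \<in> W"
begin

text \<open>Factoring the identity produces a trivial fibration \<open>p\<close> with section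
  \<open>i\<close>, and the identity is a retract of \<open>p\<close>.\<close>

lemma Id_W:
  assumes "x \<in> Obj C"
  shows "Id C x \<in> W"
proof -
  obtain d i p where *: "i \<in> Cf" "p \<in> Fb \<inter> W" "i \<in> hom C x d" "p \<in> hom C d x" "p \<cdot> i = Id C x"
    using tf.factorE[OF Id_hom[OF assms]] .
  have "is_retract C (Id C x) p"
    by (rule is_retractI[OF Id_hom *(4,3,4) Id_hom Id_hom])
      (use assms * in \<open>simp_all add: hom_Id_left hom_Id_right\<close>)
  then show ?thesis
    using W_retract * by blast
qed

text \<open>The arrow \<open>i\<close> is a retract of the idempotent \<open>i \<cdot> r\<close>,
  with identities on the codomain side.\<close>

lemma section_W:
  assumes "i \<in> hom C x y" "r \<in> hom C y x" "r \<cdot> i = Id C x" "i \<cdot> r \<in> W"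
  shows "i \<in> W"
proof -
  have y: "y \<in> Obj C"
    using homD(5)[OF assms(1)] .
  have "is_retract C i (i \<cdot> r)"
    by (rule is_retractI[OF assms(1) comp_hom[OF assms(2,1)] assms(1,2) Id_hom[OF y] Id_hom[OF y]])
      (use assms y hom_assoc[OF assms(1,2,1)] in \<open>simp_all add: hom_Id_left hom_Id_right hom_def\<close>)
  then show ?thesis
    using W_retract assms(4) by blast
qed

lemma retraction_W:
  assumes "i \<in> hom C x y" "r \<in> hom C y x" "r \<cdot> i = Id C x" "i \<cdot> r \<in> W"
  shows "r \<in> W"
  using W_cancel_right[OF assms(1,2) section_W[OF assms]] assms(3) Id_W homD(4)[OF assms(1)] by simp

section \<open>Fibrant objects and extension along acyclic cofibrations\<close>

definition fibrant_obj :: "'o \<Rightarrow> bool" where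
  "fibrant_obj x \<longleftrightarrow> x \<in> Obj C \<and> (\<forall>t f. terminal C t \<and> f \<in> hom C x t \<longrightarrow> f \<in> Fb)"

text \<open>Fibrancy quantifies over all terminal objects. One of them suffices, since they are
  isomorphic and the map to any other is a retract of \<open>p\<close>.\<close>

lemma fibrant_objI:
  assumes "p \<in> Fb" "p \<in> hom C x t" "terminal C t"
  shows "fibrant_obj x"
  unfolding fibrant_obj_def
proof (intro conjI allI impI)
  fix s f assume "terminal C s \<and> f \<in> hom C x s"
  then have s: "terminal C s" and f: "f \<in> hom C x s"
    by auto
  obtain u v where u: "u \<in> hom C s t" and v: "v \<in> hom C t s"
    using terminal_hom s assms(3) unfolding terminal_def by blast
  note x = homD(4)[OF f] and s' = homD(5)[OF f]
  have "v \<cdot> u = Id C s" "p \<cdot> Id C x = u \<cdot> f" "f \<cdot> Id C x = v \<cdot> p"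
    using terminal_unique[OF s comp_hom[OF u v] Id_hom[OF s']]
      terminal_unique[OF assms(3) comp_hom[OF Id_hom[OF x] assms(2)] comp_hom[OF f u]]
      terminal_unique[OF s comp_hom[OF Id_hom[OF x] f] comp_hom[OF assms(2) v]] by auto
  then have "is_retract C f p"
    by (intro is_retractI[OF f assms(2) Id_hom[OF x] Id_hom[OF x] u v])
      (simp_all add: x)
  then show "f \<in> Fb"
    using tc.R_retract assms(1) by blast
qed (use homD(4)[OF assms(2)] in simp)

lemma fibrant_objE:
  assumes "fibrant_obj x"
  obtains t p where "terminal C t" "p \<in> Fb" "p \<in> hom C x t"
  using assms terminal_ex terminal_hom unfolding fibrant_obj_def by metis

lemma fibrant_Obj: "fibrant_obj x \<Longrightarrow> x \<in> Obj C"
  by (simp add: fibrant_obj_def)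

lemma fibrant_domain:
  assumes "p \<in> Fb" "p \<in> hom C x y" "fibrant_obj y"
  shows "fibrant_obj x"
proof -
  obtain t q where "terminal C t" "q \<in> Fb" "q \<in> hom C y t"
    using fibrant_objE[OF assms(3)] .
  then show ?thesis
    using fibrant_objI[OF tc.R_comp[OF assms(1,2)] comp_hom[OF assms(2)]] by blast
qed

lemma fibrant_retract:
  assumes "i \<in> hom C x y" "r \<in> hom C y x" "r \<cdot> i = Id C x" "fibrant_obj y"
  shows "fibrant_obj x"
proof -
  obtain t q where t: "terminal C t" and q: "q \<in> Fb" "q \<in> hom C y t"
    using fibrant_objE[OF assms(4)] .
  note f = comp_hom[OF assms(1) q(2)]
  note t' = Id_hom[OF homD(5)[OF f]]
  have "q \<cdot> i = Id C t \<cdot> q \<cdot> i" "(q \<cdot> i) \<cdot> r = Id C t \<cdot> q"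
    using terminal_unique[OF t f comp_hom[OF f t']]
      terminal_unique[OF t comp_hom[OF assms(2) f] comp_hom[OF q(2) t']] by auto
  then have "is_retract C (q \<cdot> i) q"
    using is_retractI[OF f q(2) assms(1,2) t' t' assms(3) hom_Id_left[OF t']] by blast
  then show ?thesis
    using fibrant_objI[OF _ f t] tc.R_retract q(1) by blast
qed

lemma fibrant_extend:
  assumes "j \<in> Cf" "j \<in> W" "j \<in> hom C a b" "fibrant_obj x" "u \<in> hom C a x"
  obtains h where "h \<in> hom C b x" "h \<cdot> j = u"
proof -
  obtain t q where t: "terminal C t" and q: "q \<in> Fb" "q \<in> hom C x t"
    using fibrant_objE[OF assms(4)] .
  obtain v where v: "v \<in> hom C b t"
    using terminal_hom[OF t homD(5)[OF assms(3)]] by blast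
  have "q \<cdot> u = v \<cdot> j"
    using terminal_unique[OF t comp_hom[OF assms(5) q(2)] comp_hom[OF assms(3) v]] .
  then show thesis
    using tc.liftE[OF _ q(1) assms(3) q(2) assms(5) v] assms(1,2) that by blast
qed

lemma fibrant_replacement:
  assumes "x \<in> Obj C"
  obtains x' j where "j \<in> Cf" "j \<in> W" "j \<in> hom C x x'" "fibrant_obj x'"
proof -
  obtain t f where t: "terminal C t" and f: "f \<in> hom C x t"
    using terminal_ex terminal_hom assms by blast
  obtain d i p where "i \<in> Cf \<inter> W" "p \<in> Fb" "i \<in> hom C x d" "p \<in> hom C d t"
    using tc.factorE[OF f] by metis
  then show thesis
    using that fibrant_objI t by blast
qed

text \<open>
  A cylinder of \<open>b\<close> relative to \<open>a\<close>: the codiagonal of \<open>i\<close> is factored into a cofibration and a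
  trivial fibration \<open>s\<close>. Two maps out of \<open>b\<close> that agree on \<open>a\<close> are homotopic through it as soon as
  \<open>i\<close> is acyclic and the target is fibrant.
\<close>

lemma relative_cylinder:
  assumes i: "i \<in> Cf" "i \<in> hom C a b"
  obtains c k0 k1 s where "k0 \<in> hom C b c" "k1 \<in> hom C b c" "s \<in> hom C c b" "s \<in> Fb" "s \<in> W"
    "s \<cdot> k0 = Id C b" "s \<cdot> k1 = Id C b" "k0 \<cdot> i = k1 \<cdot> i" "k0 \<in> Cf"
    "\<And>x u v. \<lbrakk>i \<in> W; fibrant_obj x; u \<in> hom C b x; v \<in> hom C b x; u \<cdot> i = v \<cdot> i\<rbrakk>
      \<Longrightarrow> \<exists>h\<in>hom C c x. h \<cdot> k0 = u \<and> h \<cdot> k1 = v"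
proof -
  obtain j1 j0 where po: "is_pushout C i i j1 j0"
    using pushout_ex[OF i(2,2)] by blast
  obtain d where j: "j1 \<in> hom C b d" "j0 \<in> hom C b d" "j0 \<cdot> i = j1 \<cdot> i"
    using is_pushoutE[OF po] i(2) by (metis homD(3))
  note b = homD(5)[OF i(2)]
  obtain n where n: "n \<in> hom C d b" "n \<cdot> j0 = Id C b" "n \<cdot> j1 = Id C b"
    using is_pushout_lift[OF po i(2,2) j(2) Id_hom[OF b] Id_hom[OF b] HOL.refl] .
  obtain c k s where k: "k \<in> Cf" "k \<in> hom C d c" and s: "s \<in> Fb \<inter> W" "s \<in> hom C c b"
    and sk: "s \<cdot> k = n"
    using tf.factorE[OF n(1)] by metis
  show thesis
  proof (rule that[of "k \<cdot> j0" c "k \<cdot> j1" s])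
    show "k \<cdot> j0 \<in> hom C b c" "k \<cdot> j1 \<in> hom C b c"
      using comp_hom j k by blast+
    show "s \<cdot> k \<cdot> j0 = Id C b" "s \<cdot> k \<cdot> j1 = Id C b"
      using hom_assoc[OF j(2) k(2) s(2)] hom_assoc[OF j(1) k(2) s(2)] sk n by simp_all
    show "(k \<cdot> j0) \<cdot> i = (k \<cdot> j1) \<cdot> i"
      using hom_assoc[OF i(2) j(2) k(2)] hom_assoc[OF i(2) j(1) k(2)] j(3) by simp
    show "k \<cdot> j0 \<in> Cf"
      using tf.L_comp[OF tf.L_pushout[OF po i(1)] j(2) k] .
    show "\<exists>h\<in>hom C c x. h \<cdot> k \<cdot> j0 = u \<and> h \<cdot> k \<cdot> j1 = v"
      if *: "i \<in> W" "fibrant_obj x" "u \<in> hom C b x" "v \<in> hom C b x" "u \<cdot> i = v \<cdot> i" for x u v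
    proof -
      \<comment> \<open>Acyclicity passes from \<open>i\<close> to its pushout \<open>j0\<close>,
        then to the codiagonal \<open>n\<close>, then to \<open>k\<close>; so a map out of the
        pushout extends over the cylinder.\<close>
      have "j0 \<in> W"
        using tc.L_pushout[OF po] i(1) *(1) by blast
      then have "n \<in> W"
        using W_cancel_right[OF j(2) n(1)] n(2) Id_W[OF b] by simp
      then have kW: "k \<in> W"
        using W_cancel_left[OF k(2) s(2)] s(1) sk by simp
      obtain m where m: "m \<in> hom C d x" "m \<cdot> j0 = u" "m \<cdot> j1 = v"
        using is_pushout_lift[OF po i(2,2) j(2) *(3-5)] .
      obtain h where h: "h \<in> hom C c x" "h \<cdot> k = m"
        using fibrant_extend[OF k(1) kW k(2) *(2) m(1)] .
      then show ?thesis
        using m(2,3) hom_assoc[OF j(2) k(2) h(1)] hom_assoc[OF j(1) k(2) h(1)] by auto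
    qed
  qed (use s in auto)
qed

end

section \<open>Two model structures with the same cofibrations\<close>

text \<open>The primed classes stand for the localization. The structures are compared through their
  fibrant objects alone; inclusion of the fibrations is derived in
  \<open>Fb'_subset\<close>.\<close>

locale model_pair = pullbacks_pushouts C + M: model_structure C W Cf Fb + N: model_structure C W' Cf Fb'
  for C :: "('o, 'm) cat" and W Cf Fb W' Fb' +
  assumes fibrant_subset: "N.fibrant_obj x \<Longrightarrow> M.fibrant_obj x"
begin

text \<open>Both sides consist of the arrows with the right lifting property against
  \<open>Cf\<close>.\<close>

lemma trivial_fibrations: "Fb \<inter> W = Fb' \<inter> W'"
  using M.tf.R_iff N.tf.R_iff by blast

text \<open>
  Replace \<open>j\<close> by a fibration \<open>p\<close> between fibrant objects of the second structure. Up to a homotopy,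
  which can be lifted along \<open>p\<close>, a filler \<open>e\<close> exists because the target is fibrant in the first
  structure; then \<open>p\<close> has a section and is a homotopy equivalence.
\<close>

lemma acyclic_cofibration_W':
  assumes j: "j \<in> Cf" "j \<in> W"
  shows "j \<in> W'"
proof -
  obtain a b where jh: "j \<in> hom C a b"
    using M.tf.L_Arr j(1) hom_self by blast
  obtain b' k where k: "k \<in> Cf" "k \<in> W'" "k \<in> hom C b b'" and b': "N.fibrant_obj b'"
    using N.fibrant_replacement[OF homD(5)[OF jh]] .
  obtain a' i p where i: "i \<in> Cf" "i \<in> W'" "i \<in> hom C a a'" and p: "p \<in> Fb'" "p \<in> hom C a' b'"
    and pi: "p \<cdot> i = k \<cdot> j"
    using N.tc.factorE[OF comp_hom[OF jh k(3)]] by blast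
  have a': "N.fibrant_obj a'"
    using N.fibrant_domain[OF p b'] .
  obtain e0 where e0: "e0 \<in> hom C b a'" "e0 \<cdot> j = i"
    using M.fibrant_extend[OF j jh fibrant_subset[OF a'] i(3)] .
  \<comment> \<open>The extension \<open>e0\<close> makes only the upper triangle commute. Still,
    \<open>p \<cdot> e0\<close> and \<open>k\<close> agree after \<open>j\<close>, so they are
    homotopic relative to \<open>a\<close>.\<close>
  have eq: "(p \<cdot> e0) \<cdot> j = k \<cdot> j"
    using hom_assoc[OF jh e0(1) p(2)] e0(2) pi by simp
  obtain e where e: "e \<in> hom C b a'" "e \<cdot> j = i" "p \<cdot> e = k"
  proof -
    obtain c k0 k1 s where c: "k0 \<in> hom C b c" "k1 \<in> hom C b c" "s \<in> hom C c b" "s \<in> Fb" "s \<in> W"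
      "s \<cdot> k0 = Id C b" "s \<cdot> k1 = Id C b" "k0 \<cdot> j = k1 \<cdot> j" "k0 \<in> Cf"
      and homotopy: "\<And>x u v. \<lbrakk>j \<in> W; M.fibrant_obj x; u \<in> hom C b x; v \<in> hom C b x; u \<cdot> j = v \<cdot> j\<rbrakk>
        \<Longrightarrow> \<exists>h\<in>hom C c x. h \<cdot> k0 = u \<and> h \<cdot> k1 = v"
      by (rule M.relative_cylinder[OF j(1) jh]) (rule that)
    obtain h where h: "h \<in> hom C c b'" "h \<cdot> k0 = p \<cdot> e0" "h \<cdot> k1 = k"
      using homotopy[OF j(2) fibrant_subset[OF b'] comp_hom[OF e0(1) p(2)] k(3) eq] by blast
    \<comment> \<open>The cylinder was formed in the first structure, but its projection is trivial
      in both. Hence \<open>k0\<close> is acyclic in the second one and the homotopy lifts along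
      \<open>p\<close>, starting at \<open>e0\<close>.\<close>
    have "s \<in> W'"
      using c(4,5) trivial_fibrations by blast
    then have "k0 \<in> Cf \<inter> W'"
      using N.W_cancel_left[OF c(1,3)] c(6,9) N.Id_W[OF homD(5)[OF jh]] by simp
    then obtain g where g: "g \<in> hom C c a'" "g \<cdot> k0 = e0" "p \<cdot> g = h"
      using N.tc.liftE[OF _ p(1) c(1) p(2) e0(1) h(1) h(2)[symmetric]] by blast
    \<comment> \<open>The far end of the lifted homotopy corrects \<open>e0\<close>: it still
      extends \<open>i\<close>, because \<open>k0\<close> and \<open>k1\<close> agree on
      \<open>a\<close>, and it now lies over \<open>k\<close>.\<close>
    have "(g \<cdot> k1) \<cdot> j = i" "p \<cdot> g \<cdot> k1 = k"
      using hom_assoc[OF jh c(2) g(1)] hom_assoc[OF jh c(1) g(1)] c(8) g(2,3) e0(2)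
        hom_assoc[OF c(2) g(1) p(2)] h(3) by simp_all
    then show thesis
      using that comp_hom[OF c(2) g(1)] by blast
  qed
  note b'' = Id_hom[OF homD(5)[OF k(3)]] and a'' = Id_hom[OF homD(5)[OF i(3)]]
  have "p \<cdot> e = Id C b' \<cdot> k"
    using e(3) k(3) by (simp add: hom_Id_left)
  then obtain s where s: "s \<in> hom C b' a'" "s \<cdot> k = e" "p \<cdot> s = Id C b'"
    using N.tc.liftE[OF _ p(1) k(3) p(2) e(1) b''] k(1,2) by blast
  have agree: "(s \<cdot> p) \<cdot> i = Id C a' \<cdot> i"
    using hom_assoc[OF i(3) p(2) s(1)] pi hom_assoc[OF jh k(3) s(1)] s(2) e(2) hom_Id_left[OF i(3)]
    by simp
  \<comment> \<open>Both maps agree after the acyclic cofibration \<open>i\<close>, so a homotopy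
    \<open>h\<close> joins them. It is a weak equivalence because it is the identity at
    \<open>k1\<close>, and its other end is \<open>s \<cdot> p\<close>.\<close>
  have "s \<cdot> p \<in> W'"
  proof -
    obtain c k0 k1 t where c: "k0 \<in> hom C a' c" "k1 \<in> hom C a' c" "t \<in> hom C c a'"
      "t \<in> Fb'" "t \<in> W'" "t \<cdot> k0 = Id C a'" "t \<cdot> k1 = Id C a'" "k0 \<cdot> i = k1 \<cdot> i" "k0 \<in> Cf"
      and homotopy: "\<And>x u v. \<lbrakk>i \<in> W'; N.fibrant_obj x; u \<in> hom C a' x; v \<in> hom C a' x; u \<cdot> i = v \<cdot> i\<rbrakk>
        \<Longrightarrow> \<exists>h\<in>hom C c x. h \<cdot> k0 = u \<and> h \<cdot> k1 = v"
      by (rule N.relative_cylinder[OF i(1,3)]) (rule that)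
    obtain h where h: "h \<in> hom C c a'" "h \<cdot> k0 = s \<cdot> p" "h \<cdot> k1 = Id C a'"
      using homotopy[OF i(2) a' comp_hom[OF p(2) s(1)] a'' agree] by blast
    note I = N.Id_W[OF homD(5)[OF i(3)]]
    have "k0 \<in> W'" "k1 \<in> W'"
      using N.W_cancel_left[OF c(1,3,5)] N.W_cancel_left[OF c(2,3,5)] c(6,7) I by simp_all
    then show ?thesis
      using N.W_cancel_right[OF c(2) h(1)] N.W_comp[OF c(1) h(1)] h(2,3) I by simp
  qed
  then have "p \<in> W'"
    using N.retraction_W[OF s(1) p(2) s(3)] by blast
  then have "k \<cdot> j \<in> W'"
    using N.W_comp[OF i(3) p(2) i(2)] pi by simp
  then show "j \<in> W'"
    using N.W_cancel_left[OF jh k(3,2)] by blast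
qed

text \<open>A weak equivalence is an acyclic cofibration followed by a trivial fibration; the latter
  class is shared by both structures.\<close>

lemma W_subset: "f \<in> W \<Longrightarrow> f \<in> W'"
proof -
  assume f: "f \<in> W"
  then have "f \<in> Arr C"
    using M.W_Arr by blast
  then obtain x y where fh: "f \<in> hom C x y"
    using hom_self by blast
  obtain d i p where i: "i \<in> Cf" "i \<in> W" "i \<in> hom C x d" and p: "p \<in> Fb" "p \<in> hom C d y"
    and pi: "p \<cdot> i = f"
    using M.tc.factorE[OF fh] by blast
  have "p \<in> W"
    using M.W_cancel_right[OF i(3) p(2) i(2)] pi f by simp
  then have "p \<in> W'"
    using p(1) trivial_fibrations by blast
  then show "f \<in> W'"
    using N.W_comp[OF i(3) p(2) acyclic_cofibration_W'[OF i(1,2)]] pi by simp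
qed

text \<open>More weak equivalences mean more acyclic cofibrations, hence fewer arrows that lift
  against all of them.\<close>

lemma Fb'_subset: "p \<in> Fb' \<Longrightarrow> p \<in> Fb"
  using M.tc.R_iff N.tc.R_iff W_subset by blast

text \<open>Factoring in the second structure leaves an acyclic cofibration \<open>i\<close> between
  fibrant objects, which is a deformation retract. The homotopy lives on a cylinder whose projection
  also lies in \<open>W\<close>, so it shows \<open>i \<in> W\<close>.\<close>

lemma W_of_fibrant:
  assumes g: "g \<in> W'" "g \<in> hom C x y" and "N.fibrant_obj x" "N.fibrant_obj y"
  shows "g \<in> W"
proof -
  obtain d i p where i: "i \<in> Cf" "i \<in> W'" "i \<in> hom C x d" and p: "p \<in> Fb'" "p \<in> hom C d y"
    and pi: "p \<cdot> i = g"
    using N.tc.factorE[OF g(2)] by blast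
  have "p \<in> W'"
    using N.W_cancel_right[OF i(3) p(2) i(2)] pi g(1) by simp
  then have pW: "p \<in> W"
    using p(1) trivial_fibrations by blast
  note x = homD(4)[OF i(3)] and d = homD(5)[OF i(3)]
  obtain r where r: "r \<in> hom C d x" "r \<cdot> i = Id C x"
    using N.fibrant_extend[OF i assms(3) Id_hom[OF x]] .
  have agree: "(i \<cdot> r) \<cdot> i = Id C d \<cdot> i"
    using hom_assoc[OF i(3) r(1) i(3)] r(2) hom_Id_left[OF i(3)] hom_Id_right[OF i(3)] by simp
  obtain c k0 k1 t where c: "k0 \<in> hom C d c" "k1 \<in> hom C d c" "t \<in> hom C c d" "t \<in> Fb'" "t \<in> W'"
    "t \<cdot> k0 = Id C d" "t \<cdot> k1 = Id C d" "k0 \<cdot> i = k1 \<cdot> i" "k0 \<in> Cf"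
    and homotopy: "\<And>x u v. \<lbrakk>i \<in> W'; N.fibrant_obj x; u \<in> hom C d x; v \<in> hom C d x; u \<cdot> i = v \<cdot> i\<rbrakk>
      \<Longrightarrow> \<exists>h\<in>hom C c x. h \<cdot> k0 = u \<and> h \<cdot> k1 = v"
    by (rule N.relative_cylinder[OF i(1,3)]) (rule that)
  obtain h where h: "h \<in> hom C c d" "h \<cdot> k0 = i \<cdot> r" "h \<cdot> k1 = Id C d"
    using homotopy[OF i(2) N.fibrant_domain[OF p assms(4)] comp_hom[OF r(1) i(3)] Id_hom[OF d] agree]
    by blast
  note I = M.Id_W[OF d]
  have "t \<in> W"
    using c(4,5) trivial_fibrations by blast
  then have "k0 \<in> W" "k1 \<in> W"
    using M.W_cancel_left[OF c(1,3)] M.W_cancel_left[OF c(2,3)] c(6,7) I by simp_all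
  then have "i \<cdot> r \<in> W"
    using M.W_cancel_right[OF c(2) h(1)] M.W_comp[OF c(1) h(1)] h(2,3) I by simp
  then have "i \<in> W"
    using M.section_W[OF i(3) r] by blast
  then show "g \<in> W"
    using M.W_comp[OF i(3) p(2) _ pW] pi by simp
qed

definition essentially_fibrant :: "'o \<Rightarrow> bool" where
  "essentially_fibrant x \<longleftrightarrow> (\<exists>m\<in>W. \<exists>x'. m \<in> hom C x x' \<and> N.fibrant_obj x')"

lemma fibrant_essentially_fibrant: "N.fibrant_obj x \<Longrightarrow> essentially_fibrant x"
  using M.Id_W Id_hom N.fibrant_Obj unfolding essentially_fibrant_def by blast

text \<open>A replacement \<open>k\<close> of \<open>z\<close> in the second structure turns out to
  lie in \<open>W\<close>, because \<open>z\<close> is already linked by \<open>W\<close> to a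
  fibrant object \<open>d\<close> of that structure. As \<open>z\<close> is fibrant in the first
  structure, \<open>k\<close> splits, and \<open>z\<close> is a retract of a fibrant object.\<close>

lemma essentially_fibrant_approximation:
  assumes "essentially_fibrant w" and j: "j \<in> W" "j \<in> hom C w z" and z: "M.fibrant_obj z"
  shows "N.fibrant_obj z"
proof -
  obtain m w' where m: "m \<in> W" "m \<in> hom C w w'" and w': "N.fibrant_obj w'"
    using assms(1) unfolding essentially_fibrant_def by blast
  \<comment> \<open>Replacing \<open>m\<close> by the cofibration \<open>i\<close> allows
    \<open>j\<close> to be extended along it, which links \<open>d\<close> directly to
    \<open>z\<close>.\<close>
  obtain d i p where i: "i \<in> Cf" "i \<in> hom C w d" and p: "p \<in> Fb" "p \<in> W" "p \<in> hom C d w'"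
    and pi: "p \<cdot> i = m"
    using M.tf.factorE[OF m(2)] by blast
  have iW: "i \<in> W"
    using M.W_cancel_left[OF i(2) p(3,2)] pi m(1) by simp
  have "p \<in> Fb'"
    using p trivial_fibrations by blast
  then have d: "N.fibrant_obj d"
    using N.fibrant_domain[OF _ p(3) w'] by blast
  obtain t where t: "t \<in> hom C d z" "t \<cdot> i = j"
    using M.fibrant_extend[OF i(1) iW i(2) z j(2)] .
  have tW: "t \<in> W"
    using M.W_cancel_right[OF i(2) t(1) iW] t(2) j(1) by simp
  obtain z' k where k: "k \<in> Cf" "k \<in> W'" "k \<in> hom C z z'" and z': "N.fibrant_obj z'"
    using N.fibrant_replacement[OF homD(5)[OF j(2)]] .
  have "k \<cdot> t \<in> W"
    using W_of_fibrant[OF N.W_comp[OF t(1) k(3) W_subset[OF tW] k(2)] comp_hom[OF t(1) k(3)] d z'] .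
  then have kW: "k \<in> W"
    using M.W_cancel_right[OF t(1) k(3) tW] by blast
  obtain r where "r \<in> hom C z' z" "r \<cdot> k = Id C z"
    using M.fibrant_extend[OF k(1) kW k(3) z Id_hom[OF homD(5)[OF j(2)]]] .
  then show ?thesis
    using N.fibrant_retract[OF k(3) _ _ z'] by blast
qed

text \<open>Fibrant approximations taken in the first structure are fibrant in the second by
  \<open>essentially_fibrant_approximation\<close>, so two-out-of-three reduces the claim to
  \<open>W_of_fibrant\<close>.\<close>

lemma W_of_essentially_fibrant:
  assumes g: "g \<in> W'" "g \<in> hom C x y" and x: "essentially_fibrant x" and y: "essentially_fibrant y"
  shows "g \<in> W"
proof -
  obtain x' j where j: "j \<in> Cf" "j \<in> W" "j \<in> hom C x x'" and x': "M.fibrant_obj x'"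
    using M.fibrant_replacement[OF homD(4)[OF g(2)]] .
  obtain y' k where k: "k \<in> Cf" "k \<in> W" "k \<in> hom C y y'" and y': "M.fibrant_obj y'"
    using M.fibrant_replacement[OF homD(5)[OF g(2)]] .
  obtain g' where g': "g' \<in> hom C x' y'" "g' \<cdot> j = k \<cdot> g"
    using M.fibrant_extend[OF j y' comp_hom[OF g(2) k(3)]] .
  have "k \<cdot> g \<in> W'"
    using N.W_comp[OF g(2) k(3) g(1) W_subset[OF k(2)]] .
  then have "g' \<in> W'"
    using N.W_cancel_right[OF j(3) g'(1) W_subset[OF j(2)]] g'(2) by simp
  then have "g' \<in> W"
    using W_of_fibrant[OF _ g'(1)] essentially_fibrant_approximation x y j(2,3) x' k(2,3) y' by blast
  then have "k \<cdot> g \<in> W"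
    using M.W_comp[OF j(3) g'(1) j(2)] g'(2) by simp
  then show ?thesis
    using M.W_cancel_left[OF g(2) k(3,2)] by blast
qed

end

locale right_proper_pair = model_pair C W Cf Fb W' Fb'
  for C :: "('o, 'm) cat" and W Cf Fb W' Fb' +
  fixes E :: "'o set"
  assumes fibrant_E: "M.fibrant_obj x \<Longrightarrow> x \<in> E"
    and left_exact_E: "\<lbrakk>is_pullback C f p f' p'; f \<in> hom C x z; p \<in> hom C y z; f' \<in> hom C w y;
      p \<in> Fb; x \<in> E; y \<in> E; z \<in> E\<rbrakk> \<Longrightarrow> w \<in> E"
    and right_proper_E: "\<lbrakk>is_pullback C f p f' p'; f \<in> hom C x z; p \<in> hom C y z;
      p \<in> Fb; x \<in> E; y \<in> E; z \<in> E; f \<in> W\<rbrakk> \<Longrightarrow> f' \<in> W"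
begin

text \<open>
  The pullback \<open>w\<close> is compared with a pullback \<open>w'\<close> of fibrant replacements in the second structure.
  As \<open>f\<close> need not be a fibration, \<open>x\<close> is first replaced by \<open>x1\<close>, the pullback to \<open>y\<close> of a fibration
  \<open>x' \<rightarrow> y'\<close>; \<open>u\<close> is the resulting pullback. Both \<open>w \<rightarrow> u\<close> and \<open>u \<rightarrow> w'\<close> are
  admissible pullbacks of weak equivalences.
\<close>

lemma pullback_essentially_fibrant:
  assumes pb: "is_pullback C f p f' p'"
    and f: "f \<in> hom C x y" and p: "p \<in> hom C z y" "p \<in> Fb'"
    and f': "f' \<in> hom C w z" and p': "p' \<in> hom C w x"
    and E: "x \<in> E" "y \<in> E" "z \<in> E"
    and ess: "essentially_fibrant x" "essentially_fibrant y" "essentially_fibrant z"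
  shows "essentially_fibrant w"
proof -
  obtain y' jy where jy: "jy \<in> Cf" "jy \<in> W" "jy \<in> hom C y y'" and My': "M.fibrant_obj y'"
    using M.fibrant_replacement[OF homD(5)[OF f]] .
  obtain z' jz where jz: "jz \<in> Cf" "jz \<in> W" "jz \<in> hom C z z'" and Mz': "M.fibrant_obj z'"
    using M.fibrant_replacement[OF homD(4)[OF p(1)]] .
  have y': "N.fibrant_obj y'" and z': "N.fibrant_obj z'"
    using essentially_fibrant_approximation ess jy jz My' Mz' by blast+
  obtain q where q: "q \<in> hom C z' y'" "q \<cdot> jz = jy \<cdot> p"
    using M.fibrant_extend[OF jz My' comp_hom[OF p(1) jy(3)]] .
  obtain x' jx a where jx: "jx \<in> W'" "jx \<in> hom C x x'" and a: "a \<in> Fb'" "a \<in> hom C x' y'"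
    and ajx: "a \<cdot> jx = jy \<cdot> f"
    using N.tc.factorE[OF comp_hom[OF f jy(3)]] by blast
  have x': "N.fibrant_obj x'"
    using N.fibrant_domain[OF a y'] .
  \<comment> \<open>The factorization yields only \<open>jx \<in> W'\<close>; both ends are
    essentially fibrant, which improves this to \<open>W\<close>.\<close>
  have jxW: "jx \<in> W"
    using W_of_essentially_fibrant[OF jx ess(1) fibrant_essentially_fibrant[OF x']] .
  note E' = fibrant_E[OF fibrant_subset[OF x']] fibrant_E[OF My'] fibrant_E[OF Mz']
  obtain y1 a1 where pb1: "is_pullback C jy a y1 a1"
    using pullback_ex[OF jy(3) a(2)] by blast
  obtain x1 where y1: "y1 \<in> hom C x1 x'" and a1: "a1 \<in> hom C x1 y" and sq1: "jy \<cdot> a1 = a \<cdot> y1"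
    using is_pullbackE[OF pb1] jy(3) a(2) by (metis homD(2))
  have x1: "x1 \<in> E" and y1W: "y1 \<in> W"
    using left_exact_E[OF pb1 jy(3) a(2) y1] right_proper_E[OF pb1 jy(3) a(2)] Fb'_subset a(1)
      E E' jy(2) by blast+
  obtain g where g: "g \<in> hom C x x1" "a1 \<cdot> g = f" "y1 \<cdot> g = jx"
    using is_pullback_lift[OF pb1 jy(3) a(2) a1 f jx(2) ajx[symmetric]] .
  have gW: "g \<in> W"
    using M.W_cancel_left[OF g(1) y1 y1W] g(3) jxW by simp
  obtain a2 p1 where pb2: "is_pullback C a1 p a2 p1"
    using pullback_ex[OF a1 p(1)] by blast
  obtain u where a2: "a2 \<in> hom C u z" and p1: "p1 \<in> hom C u x1" and sq2: "a1 \<cdot> p1 = p \<cdot> a2"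
    using is_pullbackE[OF pb2] a1 p(1) by (metis homD(2))
  have u: "u \<in> E"
    using left_exact_E[OF pb2 a1 p(1) a2] Fb'_subset p(2) E x1 by blast
  have p1F: "p1 \<in> Fb"
    using M.tc.R_pullback[OF pb2] Fb'_subset p(2) by blast
  have sq: "f \<cdot> p' = p \<cdot> f'"
    using is_pullbackE[OF pb] by blast
  have "a1 \<cdot> g \<cdot> p' = p \<cdot> f'"
    using hom_assoc[OF p' g(1) a1] g(2) sq by simp
  then obtain n where n: "n \<in> hom C w u" "p1 \<cdot> n = g \<cdot> p'" "a2 \<cdot> n = f'"
    using is_pullback_lift[OF pb2 a1 p(1) p1 comp_hom[OF p' g(1)] f'] by blast
  \<comment> \<open>The outer rectangle is the given pullback, as \<open>a1 \<cdot> g = f\<close>.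
    Cancelling the square over \<open>a1\<close> leaves \<open>n\<close> as the base change of
    \<open>g\<close> along the fibration \<open>p1\<close>.\<close>
  have "is_pullback C g p1 n p'"
  proof (rule is_pullback_cancel[OF pb2])
    show "is_pullback C (a1 \<cdot> g) p (a2 \<cdot> n) p'"
      using pb g(2) n(3) by simp
  qed (use g n homD(2)[OF a1] homD(2)[OF a2] in auto)
  then have nW: "n \<in> W"
    using right_proper_E[OF _ g(1) p1 p1F E(1) u x1 gW] by blast
  obtain w1 w2 where pb3: "is_pullback C q a w1 w2"
    using pullback_ex[OF q(1) a(2)] by blast
  obtain w' where w1: "w1 \<in> hom C w' x'" and w2: "w2 \<in> hom C w' z'" and sq3: "q \<cdot> w2 = a \<cdot> w1"
    using is_pullbackE[OF pb3] q(1) a(2) by (metis homD(2))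
  have w2F: "w2 \<in> Fb'"
    using N.tc.R_pullback[OF pb3 a(1)] .
  have w': "N.fibrant_obj w'"
    using N.fibrant_domain[OF w2F w2 z'] .
  \<comment> \<open>The object \<open>u\<close> is also the pullback of \<open>a\<close> along
    \<open>jy \<cdot> p\<close>, which equals \<open>q \<cdot> jz\<close>. Cancelling the square of
    \<open>w'\<close> then exhibits \<open>m\<close> as the base change of \<open>jz\<close> along
    the fibration \<open>w2\<close>.\<close>
  have outer: "is_pullback C (q \<cdot> jz) a (y1 \<cdot> p1) a2"
    using is_pullback_paste[OF pb1 is_pullback_sym[OF pb2]] q(2) by simp
  then have "(q \<cdot> jz) \<cdot> a2 = a \<cdot> y1 \<cdot> p1"
    using is_pullbackE by blast
  then have "q \<cdot> jz \<cdot> a2 = a \<cdot> y1 \<cdot> p1"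
    using hom_assoc[OF a2 jz(3) q(1)] by simp
  then obtain m where m: "m \<in> hom C u w'" "w2 \<cdot> m = jz \<cdot> a2" "w1 \<cdot> m = y1 \<cdot> p1"
    using is_pullback_lift[OF pb3 q(1) a(2) w2 comp_hom[OF a2 jz(3)] comp_hom[OF p1 y1]] by blast
  have "is_pullback C jz w2 m a2"
  proof (rule is_pullback_cancel[OF pb3])
    show "is_pullback C (q \<cdot> jz) a (w1 \<cdot> m) a2"
      using outer m(3) by simp
  qed (use jz m homD(2)[OF q(1)] homD(2)[OF w1] in auto)
  then have "m \<in> W"
    using right_proper_E[OF _ jz(3) w2 Fb'_subset[OF w2F] E(3) _ E'(3) jz(2)]
      fibrant_E[OF fibrant_subset[OF w']] by blast
  then have "m \<cdot> n \<in> W"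
    using M.W_comp[OF n(1) m(1) nW] by blast
  then show ?thesis
    using comp_hom[OF n(1) m(1)] w' unfolding essentially_fibrant_def by blast
qed

end

section \<open>Pullbacks and pushouts from small diagrams\<close>

text \<open>Diagram shapes have their arrows in \<open>'m\<close>; this makes room there for the
  five arrows of a cospan.\<close>

lemma inaccessible_infinite:
  fixes \<kappa> :: "'m rel"
  assumes "inaccessible \<kappa>"
  shows "infinite (UNIV :: 'm set)"
proof -
  have \<kappa>: "Card_order \<kappa>" "natLeq <o \<kappa>"
    using assms unfolding inaccessible_def by auto
  have "natLeq \<le>o |Field \<kappa>|"
    using ordLess_imp_ordLeq[OF \<kappa>(2)] ordIso_symmetric[OF card_of_Field_ordIso[OF \<kappa>(1)]]
    by (rule ordLeq_ordIso_trans)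
  then have "infinite (Field \<kappa>)"
    using infinite_iff_natLeq_ordLeq[of "Field \<kappa>"] by simp
  then show ?thesis
    by (rule infinite_super[OF subset_UNIV])
qed

lemma finite_small:
  assumes "inaccessible \<kappa>" "finite A"
  shows "small \<kappa> A"
  using assms ordLess_transitive[of "|A|" natLeq \<kappa>]
  unfolding inaccessible_def small_def finite_iff_ordLess_natLeq by blast

text \<open>The arrows are \<open>u\<close> from \<open>a\<close> to \<open>c\<close> and
  \<open>v\<close> from \<open>b\<close> to \<open>c\<close>, and each object is its own identity.
  \<open>Comp\<close> is meaningful on composable pairs, where \<open>u\<close> and \<open>v\<close>
  can only follow an identity.\<close>

definition cospan_shape :: "'m \<Rightarrow> 'm \<Rightarrow> 'm \<Rightarrow> 'm \<Rightarrow> 'm \<Rightarrow> ('m, 'm) cat" where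
  "cospan_shape a b c u v = \<lparr>Obj = {a, b, c}, Arr = {a, b, c, u, v},
     Dom = (\<lambda>t. if t = u then a else if t = v then b else t),
     Cod = (\<lambda>t. if t = u \<or> t = v then c else t),
     Id = (\<lambda>t. t),
     Comp = (\<lambda>t s. if t \<in> {a, b, c} then s else t)\<rparr>"

context cat_struct
begin

lemma complete_pullback:
  fixes \<kappa> :: "'m rel"
  assumes \<kappa>: "inaccessible \<kappa>" and C: "complete \<kappa> C"
    and f: "f \<in> hom C x z" and p: "p \<in> hom C y z"
  shows "\<exists>f' p'. is_pullback C f p f' p'"
proof -
  obtain e :: "nat \<Rightarrow> 'm" where "inj e"
    using infinite_countable_subset[OF inaccessible_infinite[OF \<kappa>]] by blast
  then have "distinct (map e [0, 1, 2, 3, 4])"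
    by (subst distinct_map) (auto simp: inj_on_def)
  then obtain a b c u v :: 'm where "distinct [a, b, c, u, v]"
    by auto
  then have ne: "a \<noteq> b" "a \<noteq> c" "a \<noteq> u" "a \<noteq> v" "b \<noteq> c" "b \<noteq> u" "b \<noteq> v" "c \<noteq> u" "c \<noteq> v" "u \<noteq> v"
    "b \<noteq> a" "c \<noteq> a" "u \<noteq> a" "v \<noteq> a" "c \<noteq> b" "u \<noteq> b" "v \<noteq> b" "u \<noteq> c" "v \<noteq> c" "v \<noteq> u"
    by auto
  define J where "J = cospan_shape a b c u v"
  define ob where "ob t = (if t = a then x else if t = b then y else z)" for t
  define D where "D = \<lparr>fobj = (\<lambda>t\<in>{a, b, c}. ob t),
    farr = (\<lambda>t\<in>{a, b, c, u, v}. if t = u then f else if t = v then p else Id C (ob t))\<rparr>"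
  have J_sel: "Obj J = {a, b, c}" "Arr J = {a, b, c, u, v}"
    "Dom J a = a" "Dom J b = b" "Dom J c = c" "Dom J u = a" "Dom J v = b"
    "Cod J a = a" "Cod J b = b" "Cod J c = c" "Cod J u = c" "Cod J v = c" "\<And>t. Id J t = t"
    "\<And>s. Comp J a s = s" "\<And>s. Comp J b s = s" "\<And>s. Comp J c s = s"
    "\<And>s. Comp J u s = u" "\<And>s. Comp J v s = v"
    using ne by (simp_all add: J_def cospan_shape_def)
  have D_sel: "fobj D a = x" "fobj D b = y" "fobj D c = z" "farr D u = f" "farr D v = p"
    "farr D a = Id C x" "farr D b = Id C y" "farr D c = Id C z"
    using ne by (simp_all add: D_def ob_def)
  note xyz = homD(4)[OF f] homD(4)[OF p] homD(5)[OF f]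
  note arr = homD(1,2,3)[OF f] homD(1,2,3)[OF p]
  have "category J"
    unfolding category_def hom_def by (simp add: J_sel ne)
  then have small: "small_category \<kappa> J"
    using finite_small[OF \<kappa>, of "Arr J"] by (simp add: small_category_def J_sel)
  have D_ext: "fobj D \<in> extensional {a, b, c}" "farr D \<in> extensional {a, b, c, u, v}"
    by (simp_all add: D_def)
  have func: "is_functor J C D"
    unfolding is_functor_def hom_def PiE_iff by (simp add: J_sel D_sel ne xyz arr D_ext)
  obtain w \<pi> where lim: "is_limit J C D w \<pi>"
    using C small func unfolding complete_def by blast
  \<comment> \<open>The leg at \<open>c\<close> is determined by either of the others, so cones are
    commutative squares.\<close>
  have cone_iff: "is_cone J C D v' \<rho> \<longleftrightarrow> \<rho> a \<in> hom C v' x \<and> \<rho> b \<in> hom C v' y \<and> \<rho> c \<in> hom C v' z \<and>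
      f \<cdot> \<rho> a = \<rho> c \<and> p \<cdot> \<rho> b = \<rho> c" for v' \<rho>
    using homD(4)[of "\<rho> a" v' x] unfolding is_cone_def
    by (auto simp: J_sel D_sel hom_Id_left)
  have \<pi>: "\<pi> a \<in> hom C w x" "\<pi> b \<in> hom C w y" "f \<cdot> \<pi> a = p \<cdot> \<pi> b" "\<pi> c = f \<cdot> \<pi> a"
    using lim unfolding is_limit_def cone_iff by auto
  have univ: "\<exists>!h. h \<in> hom C v' w \<and> \<pi> a \<cdot> h = r \<and> \<pi> b \<cdot> h = s"
    if rs: "r \<in> hom C v' x" "s \<in> hom C v' y" "f \<cdot> r = p \<cdot> s" for v' r s
  proof -
    define \<rho> where "\<rho> t = (if t = a then r else if t = b then s else f \<cdot> r)" for t
    have \<rho>: "\<rho> a = r" "\<rho> b = s" "\<rho> c = f \<cdot> r"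
      using ne by (simp_all add: \<rho>_def)
    have "is_cone J C D v' \<rho>"
      unfolding cone_iff \<rho> using rs comp_hom[OF rs(1) f] by simp
    then have "\<exists>!h. h \<in> hom C v' w \<and> (\<forall>j\<in>Obj J. \<pi> j \<cdot> h = \<rho> j)"
      using lim unfolding is_limit_def by blast
    moreover have "h \<in> hom C v' w \<and> (\<forall>j\<in>Obj J. \<pi> j \<cdot> h = \<rho> j) \<longleftrightarrow>
        h \<in> hom C v' w \<and> \<pi> a \<cdot> h = r \<and> \<pi> b \<cdot> h = s" for h
      using hom_assoc[OF _ \<pi>(1) f, of h v'] by (auto simp: J_sel \<rho> \<pi>(4))
    ultimately show ?thesis
      by simp
  qed
  have "is_pullback C f p (\<pi> b) (\<pi> a)"
  proof (rule is_pullbackI[OF f p \<pi>(2,1,3)])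
    fix v' r s assume "r \<in> hom C v' x" "s \<in> hom C v' y" "f \<cdot> r = p \<cdot> s"
    then show "\<exists>h\<in>hom C v' w. \<pi> a \<cdot> h = r \<and> \<pi> b \<cdot> h = s"
      using univ by blast
  next
    fix v' h k assume hk: "h \<in> hom C v' w" "k \<in> hom C v' w" "\<pi> a \<cdot> h = \<pi> a \<cdot> k" "\<pi> b \<cdot> h = \<pi> b \<cdot> k"
    have "f \<cdot> \<pi> a \<cdot> k = p \<cdot> \<pi> b \<cdot> k"
      using hom_assoc[OF hk(2) \<pi>(1) f] hom_assoc[OF hk(2) \<pi>(2) p] \<pi>(3) by simp
    then have "\<exists>!h. h \<in> hom C v' w \<and> \<pi> a \<cdot> h = \<pi> a \<cdot> k \<and> \<pi> b \<cdot> h = \<pi> b \<cdot> k"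
      using univ[OF comp_hom[OF hk(2) \<pi>(1)] comp_hom[OF hk(2) \<pi>(2)]] by blast
    then show "h = k"
      using hk by blast
  qed
  then show ?thesis
    by blast
qed

lemma complete_terminal:
  fixes \<kappa> :: "'m rel"
  assumes \<kappa>: "inaccessible \<kappa>" and C: "complete \<kappa> C"
  shows "\<exists>t. terminal C t"
proof -
  define J :: "('m, 'm) cat" where "J = \<lparr>Obj = {}, Arr = {}, Dom = (\<lambda>t. t), Cod = (\<lambda>t. t),
    Id = (\<lambda>t. t), Comp = (\<lambda>t s. t)\<rparr>"
  \<comment> \<open>Functors are extensional, so over the empty shape the only one is undefined
    everywhere.\<close>
  define D :: "('m, 'm, 'o, 'm) funct" where "D = \<lparr>fobj = \<lambda>_. undefined, farr = \<lambda>_. undefined\<rparr>"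
  have "small_category \<kappa> J" "is_functor J C D"
    using finite_small[OF \<kappa>, of "{}"]
    by (simp_all add: small_category_def category_def is_functor_def J_def D_def)
  then obtain t \<pi> where "is_limit J C D t \<pi>"
    using C unfolding complete_def by blast
  then have "terminal C t"
    unfolding terminal_def is_limit_def is_cone_def by (simp add: J_def)
  then show ?thesis
    by blast
qed

end

text \<open>Colimits over the opposite shape are limits in the opposite category; pushouts thereby
  come from the construction of pullbacks.\<close>

lemma complete_op:
  fixes C :: "('o, 'm) cat" and \<kappa> :: "'m rel"
  assumes "cocomplete \<kappa> C"
  shows "complete \<kappa> (op_cat C)"
  unfolding complete_def
proof (intro allI impI)
  fix J :: "('m, 'm) cat" and D :: "('m, 'm, 'o, 'm) funct"
  assume J: "small_category \<kappa> J \<and> is_functor J (op_cat C) D"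
  then have "small_category \<kappa> (op_cat J)"
    by (simp add: small_category_def cat_struct.category_op cat_struct_def)
  moreover have "is_functor (op_cat J) C D"
    using J unfolding is_functor_def by auto
  ultimately obtain x \<iota> where "is_colimit (op_cat J) C D x \<iota>"
    using assms unfolding cocomplete_def by blast
  then have "is_limit J (op_cat C) D x \<iota>"
    unfolding is_limit_def is_colimit_def is_cone_def is_cocone_def by simp
  then show "\<exists>x \<pi>. is_limit J (op_cat C) D x \<pi>"
    by blast
qed

lemma complete_cocomplete_pullbacks_pushouts:
  assumes "category C" "inaccessible \<kappa>" "complete \<kappa> C" "cocomplete \<kappa> C"
  shows "pullbacks_pushouts C"
proof -
  interpret cat_struct C
    by (rule cat_struct.intro) fact
  show ?thesis
  proof
    fix f i x y z assume "f \<in> hom C z x" "i \<in> hom C z y"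
    then show "\<exists>f' i'. is_pushout C f i f' i'"
      using cat_struct.complete_pullback[OF cat_struct_op[OF cat_struct_axioms] assms(2)
          complete_op[OF assms(4)], of f x z i y] by (simp add: is_pushout_def)
  qed (use complete_terminal complete_pullback assms in blast)+
qed

section \<open>Local objects\<close>

lemma truncate_sel [simp]:
  "Obj (cat.truncate M) = Obj M" "Arr (cat.truncate M) = Arr M" "Dom (cat.truncate M) = Dom M"
  "Cod (cat.truncate M) = Cod M" "Id (cat.truncate M) = Id M" "Comp (cat.truncate M) = Comp M"
  by (simp_all add: cat.truncate_def)

lemma hom_truncate [simp]: "hom (cat.truncate M) = hom M"
  by (intro ext) (simp add: hom_def)

lemma category_truncate: "category M \<Longrightarrow> category (cat.truncate M)"
  by (simp add: category_def)

lemma complete_truncate: "complete \<kappa> M \<Longrightarrow> complete \<kappa> (cat.truncate M)"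
  by (simp add: complete_def is_functor_def is_limit_def is_cone_def)

lemma cocomplete_truncate: "cocomplete \<kappa> M \<Longrightarrow> cocomplete \<kappa> (cat.truncate M)"
  by (simp add: cocomplete_def is_functor_def is_colimit_def is_cocone_def)

lemma is_retract_truncate: "is_retract (cat.truncate M) = is_retract M"
  by (intro ext) (simp add: is_retract_def)

lemma has_lifting_truncate: "has_lifting (cat.truncate M) = has_lifting M"
  by (intro ext) (simp add: has_lifting_def)

lemma is_pullback_truncate: "is_pullback (cat.truncate M) = is_pullback M"
  by (intro ext) (simp add: is_pullback_def)

text \<open>The truncated record is used because M and its localization differ as records but have
  equal truncations, so both structures live on literally the same category.\<close>

lemma model_category_structure:
  assumes \<kappa>: "inaccessible \<kappa>" and M: "model_category \<kappa> M"
  shows "model_structure (cat.truncate M) (Weq M) (Cof M) (Fib M)"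
proof -
  have cat: "category M" and lim: "complete \<kappa> M" "cocomplete \<kappa> M"
    and Arr: "Weq M \<subseteq> Arr M" "Cof M \<subseteq> Arr M" "Fib M \<subseteq> Arr M"
    and weq: "\<And>f g. \<lbrakk>f \<in> Arr M; g \<in> Arr M; Cod M f = Dom M g\<rbrakk> \<Longrightarrow>
        (f \<in> Weq M \<and> g \<in> Weq M \<longrightarrow> Comp M g f \<in> Weq M) \<and>
        (f \<in> Weq M \<and> Comp M g f \<in> Weq M \<longrightarrow> g \<in> Weq M) \<and>
        (g \<in> Weq M \<and> Comp M g f \<in> Weq M \<longrightarrow> f \<in> Weq M)"
    and retract: "\<And>f g. is_retract M f g \<Longrightarrow>
        (g \<in> Weq M \<longrightarrow> f \<in> Weq M) \<and> (g \<in> Cof M \<longrightarrow> f \<in> Cof M) \<and> (g \<in> Fib M \<longrightarrow> f \<in> Fib M)"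
    and lift: "\<And>i p. \<lbrakk>i \<in> Cof M; p \<in> Fib M; i \<in> Weq M \<or> p \<in> Weq M\<rbrakk> \<Longrightarrow> has_lifting M i p"
    and factor: "\<And>f. f \<in> Arr M \<Longrightarrow> \<exists>i\<in>Cof M. \<exists>p\<in>Fib M \<inter> Weq M. Cod M i = Dom M p \<and> Comp M p i = f"
      "\<And>f. f \<in> Arr M \<Longrightarrow> \<exists>i\<in>Cof M \<inter> Weq M. \<exists>p\<in>Fib M. Cod M i = Dom M p \<and> Comp M p i = f"
    using M unfolding model_category_def by blast+
  interpret pullbacks_pushouts "cat.truncate M"
    using complete_cocomplete_pullbacks_pushouts \<kappa> category_truncate[OF cat]
      complete_truncate[OF lim(1)] cocomplete_truncate[OF lim(2)] by blast
  interpret tc: wfs "cat.truncate M" "Cof M \<inter> Weq M" "Fib M"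
    by unfold_locales
      (use Arr retract lift factor(2) in \<open>auto simp: is_retract_truncate has_lifting_truncate\<close>)
  interpret tf: wfs "cat.truncate M" "Cof M" "Fib M \<inter> Weq M"
    by unfold_locales
      (use Arr retract lift factor(1) in \<open>auto simp: is_retract_truncate has_lifting_truncate\<close>)
  show ?thesis
    by unfold_locales (use Arr retract weq in \<open>auto simp: is_retract_truncate hom_def\<close>)
qed

lemma fibrant_iff:
  assumes "model_structure (cat.truncate M) (Weq M) (Cof M) (Fib M)"
  shows "model_structure.fibrant_obj (cat.truncate M) (Fib M) x \<longleftrightarrow> fibrant M x"
  by (simp add: model_structure.fibrant_obj_def[OF assms] fibrant_def terminal_def)

text \<open>A fibrant approximation of the target of \<open>j\<close>, composed with
  \<open>j\<close>, approximates the source by the same fibrant object, so the very same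
  \<open>r\<close> arises.\<close>

lemma RMor_map_weq:
  assumes M: "model_structure (cat.truncate M) (Weq M) (Cof M) (Fib M)"
    and j: "j \<in> Weq M" and r: "RMor_map M f (Cod M j) r"
  shows "RMor_map M f (Dom M j) r"
proof -
  interpret model_structure "cat.truncate M" "Weq M" "Cof M" "Fib M"
    by fact
  have *: "fibrant_approximation M (Dom M j) (Comp M k j)" "Cod M (Comp M k j) = Cod M k"
    if k: "fibrant_approximation M (Cod M j) k" for k
  proof -
    have "j \<in> Arr M" "k \<in> Arr M" "k \<in> Weq M" "Dom M k = Cod M j" "fibrant M (Cod M k)"
      using k j W_Arr by (auto simp: fibrant_approximation_def)
    moreover from this show "Cod M (Comp M k j) = Cod M k"
      using comp_simps(3)[of j k] by simp
    ultimately show "fibrant_approximation M (Dom M j) (Comp M k j)"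
      using j W_comp[of j "Dom M j" "Cod M j" k "Cod M k"] comp_simps(2)[of j k]
      by (simp add: fibrant_approximation_def hom_def)
  qed
  show ?thesis
    using r * unfolding RMor_map_def by metis
qed

text \<open>The fibrant object \<open>Cod M j\<close> is approximated by its own identity, so an
  \<open>r\<close> computed from \<open>j\<close> is also a model for that object.\<close>

lemma RMor_map_approximation:
  assumes M: "model_structure (cat.truncate M) (Weq M) (Cof M) (Fib M)"
    and r: "RMor_map M f z r"
  obtains j where "fibrant_approximation M z j" "RMor_map M f (Cod M j) r"
proof -
  interpret model_structure "cat.truncate M" "Weq M" "Cof M" "Fib M"
    by fact
  have *: "fibrant_approximation M (Cod M j) (Id M (Cod M j))" "Cod M (Id M (Cod M j)) = Cod M j"
    if "fibrant_approximation M z j" for j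
    using that Id_W[of "Cod M j"] Id_simps[of "Cod M j"] W_Arr
    by (auto simp: fibrant_approximation_def fibrant_def)
  show thesis
    using r * that unfolding RMor_map_def by metis
qed

theorem proposition2p28:
  fixes \<kappa> :: "'m rel"
    and M N :: "('o, 'm) model_cat"
    and H :: "('o, 'm) ho_arrow set set"
    and E :: "'o set"
  assumes "inaccessible \<kappa>"
    and "combinatorial \<kappa> M" and "left_proper M"
    and "H \<subseteq> homotopy_classes M" and "small \<kappa> H"
    and "full_subcategory M E" and "admissibly_left_exact M E" and "right_proper_subcategory M E"
    and "\<And>z. fibrant M z \<Longrightarrow> z \<in> E"
    and "is_left_Bousfield_localization \<kappa> M H N"
  shows "full_subcategory N (loc \<kappa> M E H) \<and>
    admissibly_left_exact N (loc \<kappa> M E H) \<and>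
    right_proper_subcategory N (loc \<kappa> M E H) \<and>
    (\<forall>z. fibrant N z \<longrightarrow> z \<in> loc \<kappa> M E H)"
proof -
  have "model_category \<kappa> M" "model_category \<kappa> N" and tr: "cat.truncate N = cat.truncate M"
    and Cof: "Cof N = Cof M" and fib: "fibrant N z \<longleftrightarrow> local_object \<kappa> M H z \<and> fibrant M z" for z
    using assms(2,10) unfolding combinatorial_def is_left_Bousfield_localization_def by auto
  then have MM: "model_structure (cat.truncate M) (Weq M) (Cof M) (Fib M)"
    and NN: "model_structure (cat.truncate N) (Weq N) (Cof N) (Fib N)"
    using model_category_structure assms(1) by blast+
  interpret model_pair "cat.truncate M" "Weq M" "Cof M" "Fib M" "Weq N" "Fib N"
    using MM NN fibrant_iff[OF MM] fibrant_iff[OF NN] fib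
    by (simp add: tr Cof model_pair_def model_pair_axioms_def model_structure_def)
  have sel: "Obj N = Obj M" "Dom N = Dom M" "Cod N = Cod M" "is_pullback N = is_pullback M"
    using arg_cong[OF tr, of Obj] arg_cong[OF tr, of Dom] arg_cong[OF tr, of Cod]
      arg_cong[OF tr, of is_pullback] by (simp_all add: is_pullback_truncate)
  have fibM: "M.fibrant_obj z \<longleftrightarrow> fibrant M z" and fibN: "N.fibrant_obj z \<longleftrightarrow> fibrant N z" for z
    using fibrant_iff[OF MM] fibrant_iff[OF NN] by (simp_all add: tr)
  have E: "E \<subseteq> Obj M"
    using assms(6) by (simp add: full_subcategory_def)
  have admissible: "admissible_pullback M E f p f' p'"
    if "is_pullback (cat.truncate M) f p f' p'" "f \<in> hom (cat.truncate M) x z"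
      "p \<in> hom (cat.truncate M) y z" "p \<in> Fib M" "x \<in> E" "y \<in> E" "z \<in> E" for f p f' p' x y z
    using that by (simp add: admissible_pullback_def is_pullback_truncate hom_def)
  interpret right_proper_pair "cat.truncate M" "Weq M" "Cof M" "Fib M" "Weq N" "Fib N" E
  proof
    show "x \<in> E" if "M.fibrant_obj x" for x
      using that assms(9) fibM by blast
    show "w \<in> E" if "is_pullback (cat.truncate M) f p f' p'" "f \<in> hom (cat.truncate M) x z"
      "p \<in> hom (cat.truncate M) y z" "f' \<in> hom (cat.truncate M) w y" "p \<in> Fib M"
      "x \<in> E" "y \<in> E" "z \<in> E" for f p f' p' x y z w
      using admissible[OF that(1-3,5-8)] assms(7) that(4)
      unfolding admissibly_left_exact_def by (auto simp: hom_def)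
    show "f' \<in> Weq M" if "is_pullback (cat.truncate M) f p f' p'" "f \<in> hom (cat.truncate M) x z"
      "p \<in> hom (cat.truncate M) y z" "p \<in> Fib M" "x \<in> E" "y \<in> E" "z \<in> E" "f \<in> Weq M"
      for f p f' p' x y z
      using admissible[OF that(1-7)] assms(8) that(8) unfolding right_proper_subcategory_def by blast
  qed
  have approximation: "fibrant_approximation M z j \<longleftrightarrow>
      j \<in> Weq M \<and> j \<in> hom M z (Cod M j) \<and> fibrant M (Cod M j)" for z j
    using M.W_Arr by (auto simp: fibrant_approximation_def hom_def)
  have local_iff: "local_object \<kappa> M H z \<longleftrightarrow> essentially_fibrant z" if z: "z \<in> Obj M" for z
  proof
    assume loc: "local_object \<kappa> M H z"
    obtain z' j where j: "j \<in> Weq M" "j \<in> hom M z z'" and z': "fibrant M z'"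
      using M.fibrant_replacement[of z] z fibM unfolding truncate_sel hom_truncate by metis
    \<comment> \<open>Every model of a map of mapping spaces into \<open>z'\<close> is also one into
      \<open>z\<close>, where locality is known.\<close>
    have "local_object \<kappa> M H z'"
      using loc RMor_map_weq[OF MM j(1)] j(2) z'
      unfolding local_object_def RMor_iso_def fibrant_def by (auto simp: hom_def)
    then have "N.fibrant_obj z'"
      using z' fib fibN by blast
    then show "essentially_fibrant z"
      using j unfolding essentially_fibrant_def by auto
  next
    assume ess: "essentially_fibrant z"
    have "RMor_iso \<kappa> M f z" if f: "f \<in> Arr M" "\<exists>h\<in>H. represents M f h" for f
      unfolding RMor_iso_def
    proof (intro allI impI)
      fix r assume "RMor_map M f z r"
      then obtain j where j: "fibrant_approximation M z j" and r: "RMor_map M f (Cod M j) r"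
        using RMor_map_approximation[OF MM] by blast
      \<comment> \<open>The approximation \<open>j\<close> is dictated by the model
        \<open>r\<close>, so it must be arbitrary here; its target is nevertheless local, and
        \<open>r\<close> is among the models for that target.\<close>
      have "N.fibrant_obj (Cod M j)"
        using essentially_fibrant_approximation[OF ess] j fibM unfolding approximation by auto
      then have "local_object \<kappa> M H (Cod M j)"
        using fib fibN by blast
      then show "iso (Ho (sset_cat \<kappa>) (sset_weq \<kappa>)) (ho_class (sset_cat \<kappa>) (sset_weq \<kappa>) r)"
        using f r unfolding local_object_def RMor_iso_def by blast
    qed
    then show "local_object \<kappa> M H z"
      using z by (simp add: local_object_def)
  qed
  have loc: "loc \<kappa> M E H = {z \<in> E. essentially_fibrant z}"
    using local_iff E unfolding loc_def by blast
  have main: "Dom M f' \<in> loc \<kappa> M E H \<and> (f \<in> Weq N \<longrightarrow> f' \<in> Weq N)"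
    if adm: "admissible_pullback N (loc \<kappa> M E H) f p f' p'" for f p f' p'
  proof -
    have pb: "is_pullback (cat.truncate M) f p f' p'" and p: "p \<in> Fib N"
      and mem: "Dom M f \<in> E" "essentially_fibrant (Dom M f)" "Cod M f \<in> E" "essentially_fibrant (Cod M f)"
        "Dom M p \<in> E" "essentially_fibrant (Dom M p)"
      using adm unfolding admissible_pullback_def loc sel by (auto simp: is_pullback_truncate)
    obtain x y z w where h: "f \<in> hom (cat.truncate M) x y" "p \<in> hom (cat.truncate M) z y"
      "f' \<in> hom (cat.truncate M) w z" "p' \<in> hom (cat.truncate M) w x"
      using is_pullbackE[OF pb] by metis
    have eq: "Dom M f = x" "Cod M f = y" "Dom M p = z" "Dom M f' = w"
      using h by (auto simp: hom_def)
    note mem' = mem[unfolded eq]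
    have "w \<in> E"
      using left_exact_E[OF pb h(1-3) Fb'_subset[OF p] mem'(1,5,3)] .
    moreover have "essentially_fibrant w"
      using pullback_essentially_fibrant[OF pb h(1,2) p h(3,4) mem'(1,3,5,2,4,6)] .
    moreover have "f' \<in> Weq N" if f: "f \<in> Weq N"
    proof -
      have "f \<in> Weq M"
        using W_of_essentially_fibrant[OF f h(1) mem'(2,4)] .
      then show ?thesis
        using W_subset right_proper_E[OF pb h(1,2) Fb'_subset[OF p] mem'(1,5,3)] by blast
    qed
    ultimately show ?thesis
      by (simp add: loc eq)
  qed
  show ?thesis
  proof (intro conjI allI impI)
    show "full_subcategory N (loc \<kappa> M E H)"
      using E by (auto simp: full_subcategory_def loc sel)
    show "admissibly_left_exact N (loc \<kappa> M E H)" "right_proper_subcategory N (loc \<kappa> M E H)"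
      using main unfolding admissibly_left_exact_def right_proper_subcategory_def sel by blast+
    show "z \<in> loc \<kappa> M E H" if "fibrant N z" for z
      using that fib assms(9) by (simp add: loc_def)
  qed
qed

end
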